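(* Let $\mathbb F$ be a nonabelian free group of finite rank. Then $f'_{\mathbb F}(1)\ge 2$, and for all positive integers $m,n$, $$f'_{\mathbb F}(m+n)\ \ge\ f'_{\mathbb F}(m)\,f'_{\mathbb F}(n).$$
   Context: Commutators are $[a,b]=aba^{-1}b^{-1}$. For a positive integer $g$, let $H_g=\langle a_1,b_1,\dots,a_g,b_g\rangle$ be the free group of rank $2g$ on the indicated basis (the fundamental group of a compact orientable surface of genus $g$ with one boundary component), and let $\partial_g=[a_1,b_1]\cdots[a_g,b_g]\in H_g$. For $x\in\mathbb F$, a genus $g$ representation of $x$ is a homomorphism $h:H_g\to\mathbb F$ with $h(\partial_g)=x$. A subgroup $S$ of a group $G$ is called primitive if it is closed under taking roots: $t\in G$, $n\ge1$ and $t^n\in S$ imply $t\in S$. A genus $g$ representation $h$ of $x\in\mathbb F$ is admissible if $h$ is injective and its image $h(H_g)$ is a primitive subgroup of $\mathbb F$. For $x\in\mathbb F$, let $\mathrm{num}'_g(x)$ be the number of distinct subgroups of $\mathbb F$ of the form $h(H_g)$, where $h$ ranges over the admissible genus $g$ representations of $x$. Finally, $f'_{\mathbb F}(g)=\sup\{\mathrm{num}'_g(x)\mid x\in\mathbb F\}$. *)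

theory Defs
  imports "HOL-Algebra.Elementary_Groups" "HOL-Library.Extended_Nat"
begin

section \<open>Free groups\<close>

text \<open>The free group on a set \<open>X\<close> consists of the reduced words over \<open>X\<close>. The letter
  \<open>(x, True)\<close> stands for the generator \<open>x\<close> and \<open>(x, False)\<close> for its inverse.\<close>

definition inv_letter :: "'a \<times> bool \<Rightarrow> 'a \<times> bool" where
  "inv_letter l = (fst l, \<not> snd l)"

definition reduced :: "('a \<times> bool) list \<Rightarrow> bool" where
  "reduced w \<longleftrightarrow> successively (\<lambda>l l'. l' \<noteq> inv_letter l) w"

definition cancel_cons :: "'a \<times> bool \<Rightarrow> ('a \<times> bool) list \<Rightarrow> ('a \<times> bool) list" where
  "cancel_cons l w =
     (case w of [] \<Rightarrow> [l] | l' # w' \<Rightarrow> if l' = inv_letter l then w' else l # w)"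

text \<open>On reduced words \<open>u\<close> and \<open>v\<close>, the word \<open>foldr cancel_cons u v\<close> is the reduced form of
  \<open>u @ v\<close>: the letters of \<open>u\<close> are put in front of \<open>v\<close> one at a time, cancelling when possible.\<close>

definition free_group :: "'a set \<Rightarrow> ('a \<times> bool) list monoid" where
  "free_group X =
     \<lparr>carrier = {w. reduced w \<and> fst ` set w \<subseteq> X}, mult = foldr cancel_cons, one = []\<rparr>"

definition free_gen :: "'a \<Rightarrow> ('a \<times> bool) list" where
  "free_gen x = [(x, True)]"

lemma inv_letter_inv_letter [simp]: "inv_letter (inv_letter l) = l"
  by (simp add: inv_letter_def)

lemma fst_inv_letter [simp]: "fst (inv_letter l) = fst l"
  by (simp add: inv_letter_def)

lemma reduced_Nil [simp]: "reduced []"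
  by (simp add: reduced_def)

lemma reduced_ConsD: "reduced (l # w) \<Longrightarrow> reduced w"
  by (cases w) (auto simp: reduced_def)

lemma reduced_cancel_cons: "reduced w \<Longrightarrow> reduced (cancel_cons l w)"
  by (cases w) (auto simp: cancel_cons_def dest: reduced_ConsD, auto simp: reduced_def)

lemma cancel_cons_reduced: "reduced (l # w) \<Longrightarrow> cancel_cons l w = l # w"
  by (cases w) (auto simp: cancel_cons_def reduced_def)

lemma cancel_cons_inv_letter:
  assumes "reduced w"
  shows "cancel_cons l (cancel_cons (inv_letter l) w) = w"
proof (cases w)
  case (Cons l' w')
  show ?thesis
  proof (cases "l' = l")
    case True
    then show ?thesis
      using assms cancel_cons_reduced[of l w'] Cons by (simp add: cancel_cons_def)
  qed (simp add: Cons cancel_cons_def)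
qed (simp add: cancel_cons_def)

lemma cancel_cons_letters: "fst ` set (cancel_cons l w) \<subseteq> insert (fst l) (fst ` set w)"
  by (cases w) (auto simp: cancel_cons_def)

lemma reduced_foldr: "reduced v \<Longrightarrow> reduced (foldr cancel_cons u v)"
  by (induction u) (auto intro: reduced_cancel_cons)

lemma foldr_letters: "fst ` set (foldr cancel_cons u v) \<subseteq> fst ` set u \<union> fst ` set v"
proof (induction u)
  case (Cons l u)
  have "fst ` set (foldr cancel_cons (l # u) v)
      \<subseteq> insert (fst l) (fst ` set (foldr cancel_cons u v))"
    using cancel_cons_letters[of l "foldr cancel_cons u v"] by simp
  also have "\<dots> \<subseteq> insert (fst l) (fst ` set u \<union> fst ` set v)"
    using Cons.IH by (rule insert_mono)
  finally show ?case by simp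
qed simp

lemma foldr_Nil: "reduced u \<Longrightarrow> foldr cancel_cons u [] = u"
proof (induction u)
  case (Cons l u)
  then show ?case using reduced_ConsD[OF Cons.prems] by (simp add: cancel_cons_reduced)
qed simp

lemma foldr_cancel_cons:
  assumes "reduced z"
  shows "foldr cancel_cons (cancel_cons l w) z = cancel_cons l (foldr cancel_cons w z)"
proof (cases w)
  case (Cons l' w')
  then show ?thesis
    using cancel_cons_inv_letter[OF reduced_foldr[OF assms, of w'], of l]
    by (auto simp: cancel_cons_def[of l "_ # _"])
qed (simp add: cancel_cons_def)

lemma foldr_assoc:
  "reduced z \<Longrightarrow>
    foldr cancel_cons (foldr cancel_cons u v) z = foldr cancel_cons u (foldr cancel_cons v z)"
  by (induction u) (auto simp: foldr_cancel_cons)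

lemma foldr_inverse: "foldr cancel_cons (rev (map inv_letter u)) u = []"
  by (induction u) (auto simp: cancel_cons_def)

lemma reduced_inverse: "reduced u \<Longrightarrow> reduced (rev (map inv_letter u))"
  by (induction u)
    (auto simp: reduced_def successively_append_iff successively_Cons last_rev hd_map)

lemma group_free_group: "group (free_group X)"
proof (rule groupI)
  fix x assume x: "x \<in> carrier (free_group X)"
  have "rev (map inv_letter x) \<in> carrier (free_group X)"
    using x by (force simp: free_group_def intro: reduced_inverse)
  moreover have "rev (map inv_letter x) \<otimes>\<^bsub>free_group X\<^esub> x = \<one>\<^bsub>free_group X\<^esub>"
    by (simp add: free_group_def foldr_inverse)
  ultimately show "\<exists>y\<in>carrier (free_group X). y \<otimes>\<^bsub>free_group X\<^esub> x = \<one>\<^bsub>free_group X\<^esub>"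
    by blast
next
  fix x y assume "x \<in> carrier (free_group X)" "y \<in> carrier (free_group X)"
  then have "reduced y" and "fst ` set x \<union> fst ` set y \<subseteq> X" by (simp_all add: free_group_def)
  then have "fst ` set (foldr cancel_cons x y) \<subseteq> X" using foldr_letters[of x y] by (metis order_trans)
  then show "x \<otimes>\<^bsub>free_group X\<^esub> y \<in> carrier (free_group X)"
    using \<open>reduced y\<close> by (simp add: free_group_def reduced_foldr)
qed (auto simp: free_group_def foldr_assoc)

lemma free_gen_closed: "x \<in> X \<Longrightarrow> free_gen x \<in> carrier (free_group X)"
  by (simp add: free_group_def free_gen_def reduced_def)

text \<open>The universal property: every map from \<open>X\<close> to a group extends uniquely to a
  homomorphism on the free group on \<open>X\<close>.\<close>

definition free_lift :: "('b, 'c) monoid_scheme \<Rightarrow> ('a \<Rightarrow> 'b) \<Rightarrow> ('a \<times> bool) list \<Rightarrow> 'b" where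
  "free_lift G f w =
     foldr (\<lambda>l g. (if snd l then f (fst l) else inv\<^bsub>G\<^esub> f (fst l)) \<otimes>\<^bsub>G\<^esub> g) w \<one>\<^bsub>G\<^esub>"

context group
begin

lemma free_lift_closed:
  "f ` X \<subseteq> carrier G \<Longrightarrow> fst ` set w \<subseteq> X \<Longrightarrow> free_lift G f w \<in> carrier G"
  by (induction w) (auto simp: free_lift_def intro!: m_closed inv_closed)

lemma free_lift_cancel_cons:
  assumes "f ` X \<subseteq> carrier G" "fst l \<in> X" "fst ` set w \<subseteq> X"
  shows "free_lift G f (cancel_cons l w) =
    (if snd l then f (fst l) else inv f (fst l)) \<otimes> free_lift G f w"
proof (cases "\<exists>w'. w = inv_letter l # w'")
  case True
  then obtain w' where w: "w = inv_letter l # w'" by blast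
  have "free_lift G f w' \<in> carrier G" using free_lift_closed assms w by auto
  moreover have "f (fst l) \<in> carrier G" using assms by auto
  ultimately show ?thesis
    by (simp add: w cancel_cons_def) (simp add: free_lift_def inv_letter_def m_assoc[symmetric])
next
  case False
  then have "cancel_cons l w = l # w" by (cases w) (auto simp: cancel_cons_def)
  then show ?thesis by (simp add: free_lift_def)
qed

lemma free_lift_hom:
  assumes f: "f ` X \<subseteq> carrier G"
  shows "free_lift G f \<in> hom (free_group X) G"
proof (rule homI)
  fix u v assume "u \<in> carrier (free_group X)" "v \<in> carrier (free_group X)"
  then have "fst ` set u \<subseteq> X" and v: "fst ` set v \<subseteq> X" by (auto simp: free_group_def)
  then have "free_lift G f (foldr cancel_cons u v) = free_lift G f u \<otimes> free_lift G f v"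
  proof (induction u)
    case Nil
    then show ?case using free_lift_closed[OF f v] by (simp add: free_lift_def)
  next
    case (Cons l u)
    define c where "c = (if snd l then f (fst l) else inv f (fst l))"
    have c: "c \<in> carrier G" using Cons.prems f by (auto simp: c_def)
    have "fst ` set u \<union> fst ` set v \<subseteq> X" using Cons.prems by simp
    then have uv: "fst ` set (foldr cancel_cons u v) \<subseteq> X"
      using foldr_letters[of u v] by (metis order_trans)
    have "free_lift G f (foldr cancel_cons (l # u) v)
        = c \<otimes> free_lift G f (foldr cancel_cons u v)"
      using free_lift_cancel_cons[OF f _ uv, of l] Cons.prems by (simp add: c_def)
    also have "\<dots> = c \<otimes> free_lift G f u \<otimes> free_lift G f v"
      using Cons free_lift_closed[OF f, of u] free_lift_closed[OF f v] c by (simp add: m_assoc)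
    also have "c \<otimes> free_lift G f u = free_lift G f (l # u)"
      by (simp add: free_lift_def c_def)
    finally show ?case .
  qed
  then show "free_lift G f (u \<otimes>\<^bsub>free_group X\<^esub> v) = free_lift G f u \<otimes> free_lift G f v"
    by (simp add: free_group_def)
qed (use free_lift_closed[OF f] in \<open>auto simp: free_group_def\<close>)

lemma free_lift_gen: "f x \<in> carrier G \<Longrightarrow> free_lift G f (free_gen x) = f x"
  by (simp add: free_lift_def free_gen_def)

lemma free_hom_unique:
  assumes h: "h \<in> hom (free_group X) G" and w: "w \<in> carrier (free_group X)"
  shows "h w = free_lift G (h \<circ> free_gen) w"
  using w
proof (induction w)
  case Nil
  then show ?case
    using hom_one[OF h group_free_group] by (simp add: free_lift_def free_group_def)
next
  case (Cons l w)
  interpret F: group "free_group X" by (rule group_free_group)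
  interpret h: group_hom "free_group X" G h
    using h by unfold_locales
  have red: "reduced (l # w)" and lX: "fst l \<in> X" and w: "w \<in> carrier (free_group X)"
    using Cons.prems reduced_ConsD[of l w] by (simp_all add: free_group_def)
  have l: "[l] \<in> carrier (free_group X)"
    using lX by (simp add: free_group_def reduced_def)
  have "[l] \<otimes>\<^bsub>free_group X\<^esub> w = l # w"
    using cancel_cons_reduced[OF red] by (simp add: free_group_def)
  then have "h (l # w) = h [l] \<otimes> h w" using h.hom_mult[OF l w] by simp
  moreover have "h [l] = (if snd l then h (free_gen (fst l)) else inv h (free_gen (fst l)))"
  proof (cases "snd l")
    case True
    then have "[l] = free_gen (fst l)" by (cases l) (simp add: free_gen_def)
    then show ?thesis using True by simp
  next
    case False
    then have "[l] \<otimes>\<^bsub>free_group X\<^esub> free_gen (fst l) = \<one>\<^bsub>free_group X\<^esub>"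
      by (cases l) (simp add: free_group_def free_gen_def cancel_cons_def inv_letter_def)
    then have "inv\<^bsub>free_group X\<^esub> free_gen (fst l) = [l]"
      by (intro F.inv_equality l free_gen_closed lX)
    then show ?thesis using False h.hom_inv[OF free_gen_closed[OF lX]] by auto
  qed
  ultimately show ?case using Cons.IH[OF w] by (simp add: free_lift_def)
qed

end

definition free_of_finite_rank :: "('a, 'b) monoid_scheme \<Rightarrow> bool" where
  "free_of_finite_rank G \<longleftrightarrow> (\<exists>r::nat. G \<cong> free_group {..<r})"

section \<open>Genus g representations\<close>

definition commutator :: "('a, 'b) monoid_scheme \<Rightarrow> 'a \<Rightarrow> 'a \<Rightarrow> 'a" where
  "commutator G a b = a \<otimes>\<^bsub>G\<^esub> b \<otimes>\<^bsub>G\<^esub> inv\<^bsub>G\<^esub> a \<otimes>\<^bsub>G\<^esub> inv\<^bsub>G\<^esub> b"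

datatype surface_gen = gen_a nat | gen_b nat

definition surface_group :: "nat \<Rightarrow> (surface_gen \<times> bool) list monoid" where
  "surface_group g = free_group (gen_a ` {1..g} \<union> gen_b ` {1..g})"

definition boundary :: "nat \<Rightarrow> (surface_gen \<times> bool) list" where
  "boundary g =
     foldr (\<lambda>i w. commutator (surface_group g) (free_gen (gen_a i)) (free_gen (gen_b i))
                    \<otimes>\<^bsub>surface_group g\<^esub> w)
       [1..<Suc g] \<one>\<^bsub>surface_group g\<^esub>"

definition genus_reps ::
  "('a, 'b) monoid_scheme \<Rightarrow> nat \<Rightarrow> 'a \<Rightarrow> ((surface_gen \<times> bool) list \<Rightarrow> 'a) set" where
  "genus_reps F g x = {h \<in> hom (surface_group g) F. h (boundary g) = x}"

definition primitive_subgroup :: "'a set \<Rightarrow> ('a, 'b) monoid_scheme \<Rightarrow> bool" where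
  "primitive_subgroup S G \<longleftrightarrow>
     subgroup S G \<and> (\<forall>t\<in>carrier G. \<forall>n::nat. n \<ge> 1 \<longrightarrow> t [^]\<^bsub>G\<^esub> n \<in> S \<longrightarrow> t \<in> S)"

definition admissible_reps ::
  "('a, 'b) monoid_scheme \<Rightarrow> nat \<Rightarrow> 'a \<Rightarrow> ((surface_gen \<times> bool) list \<Rightarrow> 'a) set" where
  "admissible_reps F g x =
     {h \<in> genus_reps F g x. inj_on h (carrier (surface_group g)) \<and>
        primitive_subgroup (h ` carrier (surface_group g)) F}"

text \<open>Cardinalities are taken in the extended naturals, so that an infinite set does not get
  cardinality \<open>0\<close> and the supremum below exists unconditionally (it may be \<open>\<infinity>\<close>).\<close>

definition ecard :: "'a set \<Rightarrow> enat" where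
  "ecard S = (if finite S then enat (card S) else \<infinity>)"

definition num_admissible :: "('a, 'b) monoid_scheme \<Rightarrow> nat \<Rightarrow> 'a \<Rightarrow> enat" where
  "num_admissible F g x = ecard {h ` carrier (surface_group g) | h. h \<in> admissible_reps F g x}"

definition sup_admissible :: "('a, 'b) monoid_scheme \<Rightarrow> nat \<Rightarrow> enat" where
  "sup_admissible F g = (SUP x\<in>carrier F. num_admissible F g x)"

end

theory Submission
  imports Defs
begin

text \<open>Superadditivity: \<open>\<bbbF>\<close> contains a primitive copy of a free product \<open>\<bbbF> * \<bbbF>\<close>. Indeed, the
  kernel of a homomorphism onto \<open>\<int>\<close> is primitive since \<open>\<int>\<close> is torsion-free, and it is free of
  infinite rank. If \<open>S\<close> and \<open>T\<close> are images of admissible representations of \<open>x\<close> and \<open>y\<close> in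
  the two factors, then \<open>S * T\<close> is the image of an admissible representation of \<open>x y\<close>, and it
  determines \<open>S\<close> and \<open>T\<close>.

  Roots are handled by writing an element as a reduced product \<open>u c u\<^sup>-\<^sup>1\<close> with \<open>c\<close> cyclically
  reduced, so that its powers are the reduced words \<open>u c\<^sup>n u\<^sup>-\<^sup>1\<close>.

  Genus one: \<open>[ab\<^sup>2, a\<^sup>-\<^sup>1ba\<^sup>-\<^sup>2] = [ab\<^sup>2a\<^sup>-\<^sup>1ba\<^sup>-\<^sup>1, a\<^sup>-\<^sup>1b\<^sup>-\<^sup>1a\<^sup>-\<^sup>1]\<close>, but the two pairs generate
  different free subgroups. Both are primitive because in their Stallings graphs a reduced word of
  length \<open>4\<close> can be read from at most one vertex.\<close>

section \<open>Reduced words and roots\<close>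

text \<open>The elements \<open>x\<close> and \<open>y\<close> with large counts live over the same
  letters, so their product need not remember the two factors; it does when the alphabets are
  disjoint. A group of rank \<open>r\<close> has only \<open>r\<close> letters, and a subgroup of
  finite index, although its rank may be large, does not help: every element has a power in it, so
  it is primitive only if it is the whole group. This is why room is sought in a subgroup of
  infinite index. Over disjoint alphabets nothing cancels between a word of \<open>S\<close> and a
  word of \<open>T\<close>. The elements of \<open>S * T\<close> are therefore literal
  concatenations, and the arguments about them reduce to locating the places where the alphabet
  changes. The kernel and the two genus one subgroups are treated alike. Each is the group of loops
  of a folded graph whose edges carry outputs: the outputs rewrite a loop in a basis, which gives
  freeness, and closure under roots is a property of the paths. The graph of the kernel is infinite
  but explicit; the other two are finite and checked by evaluation.\<close>

definition word_inv :: "('a \<times> bool) list \<Rightarrow> ('a \<times> bool) list" where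
  "word_inv w = rev (map inv_letter w)"

lemma word_inv_Nil [simp]: "word_inv [] = []"
  by (simp add: word_inv_def)

lemma word_inv_eq_Nil [simp]: "word_inv w = [] \<longleftrightarrow> w = []"
  by (simp add: word_inv_def)

lemma word_inv_append: "word_inv (u @ v) = word_inv v @ word_inv u"
  by (simp add: word_inv_def)

lemma word_inv_word_inv [simp]: "word_inv (word_inv w) = w"
  by (simp add: word_inv_def rev_map o_def)

lemma letters_word_inv [simp]: "fst ` set (word_inv w) = fst ` set w"
  by (force simp: word_inv_def)

lemma reduced_word_inv: "reduced w \<Longrightarrow> reduced (word_inv w)"
  by (simp add: word_inv_def reduced_inverse)

lemma inv_letter_neq [simp]: "inv_letter l \<noteq> l" "l \<noteq> inv_letter l"
  by (auto simp: inv_letter_def prod_eq_iff)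

lemma reduced_append_iff:
  "reduced (u @ v) \<longleftrightarrow>
    reduced u \<and> reduced v \<and> (u = [] \<or> v = [] \<or> hd v \<noteq> inv_letter (last u))"
  by (auto simp: reduced_def successively_append_iff)

lemma foldr_cancel_cons_append: "reduced (u @ v) \<Longrightarrow> foldr cancel_cons u v = u @ v"
proof (induction u)
  case (Cons l u)
  then show ?case using reduced_ConsD[of l "u @ v"] by (simp add: cancel_cons_reduced)
qed simp

lemma mem_free_group: "w \<in> carrier (free_group X) \<longleftrightarrow> reduced w \<and> fst ` set w \<subseteq> X"
  by (simp add: free_group_def)

lemma mult_free_group: "u \<otimes>\<^bsub>free_group X\<^esub> v = foldr cancel_cons u v"
  by (simp add: free_group_def)

lemma one_free_group: "\<one>\<^bsub>free_group X\<^esub> = []"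
  by (simp add: free_group_def)

lemma mult_reduced: "reduced (u @ v) \<Longrightarrow> u \<otimes>\<^bsub>free_group X\<^esub> v = u @ v"
  by (simp add: mult_free_group foldr_cancel_cons_append)

lemma inv_free_group:
  assumes "w \<in> carrier (free_group X)"
  shows "inv\<^bsub>free_group X\<^esub> w = word_inv w"
proof (rule group.inv_equality[OF group_free_group _ assms])
  show "word_inv w \<otimes>\<^bsub>free_group X\<^esub> w = \<one>\<^bsub>free_group X\<^esub>"
    by (simp add: word_inv_def mult_free_group one_free_group foldr_inverse)
  show "word_inv w \<in> carrier (free_group X)"
    using assms by (simp add: mem_free_group reduced_word_inv)
qed

lemma inv_free_gen: "x \<in> X \<Longrightarrow> inv\<^bsub>free_group X\<^esub> free_gen x = [(x, False)]"
  by (simp add: inv_free_group free_gen_closed) (simp add: free_gen_def word_inv_def inv_letter_def)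

text \<open>For a nonempty word, \<open>reduced (c @ c)\<close> is cyclic reducedness. As long as it
  fails, the outer letters are mutually inverse and move into \<open>u\<close>.\<close>

lemma cyclic_reduction:
  assumes "reduced t" "t \<noteq> []"
  shows "\<exists>u c. t = u @ c @ word_inv u \<and> c \<noteq> [] \<and> reduced (c @ c)"
  using assms
proof (induction "length t" arbitrary: t rule: less_induct)
  case less
  show ?case
  proof (cases "reduced (t @ t)")
    case True
    then show ?thesis using less.prems by (intro exI[of _ "[]"] exI[of _ t]) simp
  next
    case False
    then have hl: "hd t = inv_letter (last t)"
      using less.prems by (simp add: reduced_append_iff)
    obtain l t1 where t1: "t = l # t1" using less.prems by (cases t) auto
    have "t1 \<noteq> []" using hl t1 by auto
    then obtain t2 l' where t2: "t1 = t2 @ [l']" by (metis rev_exhaust)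
    have l': "l' = inv_letter l" using hl t1 t2 by simp
    \<comment> \<open>If \<open>t2\<close> were empty, \<open>t\<close> would be
      \<open>[l, inv_letter l]\<close>, which is not reduced.\<close>
    have red: "reduced t2" "t2 \<noteq> []"
      using less.prems t1 t2 l' by (auto simp: reduced_def successively_Cons successively_append_iff)
    then obtain u c where "t2 = u @ c @ word_inv u" "c \<noteq> []" "reduced (c @ c)"
      using less.hyps[of t2] t1 t2 by auto
    then show ?thesis
      by (intro exI[of _ "l # u"] exI[of _ c]) (simp add: t1 t2 l' word_inv_def)
  qed
qed

lemma concat_replicate_Suc2: "concat (replicate (Suc n) c) = concat (replicate n c) @ c"
  by (induction n) simp_all

lemma hd_concat_replicate: "n \<ge> 1 \<Longrightarrow> c \<noteq> [] \<Longrightarrow> hd (concat (replicate n c)) = hd c"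
  by (cases n) auto

lemma last_concat_replicate: "n \<ge> 1 \<Longrightarrow> c \<noteq> [] \<Longrightarrow> last (concat (replicate n c)) = last c"
  by (cases n) (auto simp: concat_replicate_Suc2 simp del: replicate_Suc)

lemma reduced_concat_replicate:
  assumes "reduced (c @ c)"
  shows "reduced (concat (replicate n c))"
proof (induction n)
  case (Suc n)
  then show ?case
    using assms hd_concat_replicate[of n c] by (cases n) (auto simp: reduced_append_iff)
qed simp

text \<open>A power of \<open>c\<close> starts and ends with the same letters as \<open>c\<close>,
  so the two seams with \<open>u\<close> are those already present in
  \<open>u @ c @ word_inv u\<close>.\<close>

lemma reduced_conj_replicate:
  assumes "reduced (c @ c)" "c \<noteq> []" "reduced (u @ c @ word_inv u)" "n \<ge> 1"
  shows "reduced (u @ concat (replicate n c) @ word_inv u)"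
proof -
  have "concat (replicate n c) \<noteq> []" using assms(2,4) by (cases n) auto
  then show ?thesis
    using assms reduced_concat_replicate[OF assms(1), of n]
      hd_concat_replicate[OF assms(4,2)] last_concat_replicate[OF assms(4,2)]
    by (auto simp: reduced_append_iff)
qed

lemma (in group) conj_pow:
  assumes "u \<in> carrier G" "c \<in> carrier G"
  shows "(u \<otimes> c \<otimes> inv u) [^] (n::nat) = u \<otimes> c [^] n \<otimes> inv u"
proof (induction n)
  case (Suc n)
  have "(u \<otimes> c \<otimes> inv u) [^] Suc n = u \<otimes> c [^] n \<otimes> (inv u \<otimes> u) \<otimes> c \<otimes> inv u"
    using Suc assms by (simp only: nat_pow_Suc) (simp only: m_assoc m_closed inv_closed nat_pow_closed)
  then show ?case using assms by (simp add: m_assoc)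
qed (use assms in simp)

lemma pow_cyclically_reduced:
  assumes "reduced (c @ c)"
  shows "c [^]\<^bsub>free_group X\<^esub> (n::nat) = concat (replicate n c)"
proof (induction n)
  case 0
  then show ?case using group.is_monoid[OF group_free_group, THEN monoid.nat_pow_0]
    by (simp add: one_free_group)
next
  case (Suc n)
  have "reduced (concat (replicate n c) @ c)"
    using reduced_concat_replicate[OF assms, of "Suc n"] by (simp only: concat_replicate_Suc2)
  then have "concat (replicate n c) \<otimes>\<^bsub>free_group X\<^esub> c = concat (replicate (Suc n) c)"
    by (simp only: mult_reduced concat_replicate_Suc2)
  then show ?case
    using Suc group.is_monoid[OF group_free_group, THEN monoid.nat_pow_Suc, of X c n] by simp
qed

lemma pow_conj_cyclically_reduced:
  assumes t: "u @ c @ word_inv u \<in> carrier (free_group X)"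
    and c: "reduced (c @ c)" "c \<noteq> []" and n: "n \<ge> 1"
  shows "(u @ c @ word_inv u) [^]\<^bsub>free_group X\<^esub> (n::nat)
    = u @ concat (replicate n c) @ word_inv u"
proof -
  interpret group "free_group X" by (rule group_free_group)
  have u: "u \<in> carrier (free_group X)" and cc: "c \<in> carrier (free_group X)"
    using t by (auto simp: mem_free_group reduced_append_iff)
  have r: "reduced (u @ concat (replicate n c) @ word_inv u)" if "n \<ge> 1" for n
    using reduced_conj_replicate[OF c _ that] t by (simp add: mem_free_group)
  have *: "u \<otimes>\<^bsub>free_group X\<^esub> concat (replicate n c) \<otimes>\<^bsub>free_group X\<^esub> inv\<^bsub>free_group X\<^esub> u
      = u @ concat (replicate n c) @ word_inv u" if "n \<ge> 1" for n
  proof -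
    have "reduced (u @ concat (replicate n c))"
      using r[OF that] by (metis append.assoc reduced_append_iff)
    then show ?thesis using r[OF that] by (simp add: inv_free_group[OF u] mult_reduced)
  qed
  have "u @ c @ word_inv u = u \<otimes>\<^bsub>free_group X\<^esub> c \<otimes>\<^bsub>free_group X\<^esub> inv\<^bsub>free_group X\<^esub> u"
    using *[of 1] by simp
  then show ?thesis
    using conj_pow[OF u cc, of n] *[OF n] by (simp add: pow_cyclically_reduced[OF c(1)])
qed

lemma fst_hd_word_inv: "w \<noteq> [] \<Longrightarrow> fst (hd (word_inv w)) = fst (last w)"
  by (simp add: word_inv_def hd_rev last_map)

section \<open>Free products of subgroups in complementary letters\<close>

text \<open>The free product \<open>S * T\<close> inside a larger free group, given by uncancelled
  concatenations so that words can be cut. Neighbouring blocks may come from the same factor; only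
  the whole word has to be reduced.\<close>

definition block_words ::
  "('a \<times> bool) list set \<Rightarrow> ('a \<times> bool) list set \<Rightarrow> ('a \<times> bool) list set" where
  "block_words S T = {w. reduced w \<and> (\<exists>bs. w = concat bs \<and> set bs \<subseteq> S \<union> T)}"

lemma block_words_commute: "block_words S T = block_words T S"
  by (simp add: block_words_def Un_commute)

lemma block_words_append:
  assumes "u \<in> block_words S T" "v \<in> block_words S T" "reduced (u @ v)"
  shows "u @ v \<in> block_words S T"
proof -
  obtain bs cs where "u = concat bs" "set bs \<subseteq> S \<union> T" "v = concat cs" "set cs \<subseteq> S \<union> T"
    using assms by (auto simp: block_words_def)
  then show ?thesis using assms(3)
    by (auto simp: block_words_def intro!: exI[of _ "bs @ cs"])
qed

lemma block_words_Nil [simp]: "[] \<in> block_words S T"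
  by (auto simp: block_words_def intro!: exI[of _ "[]"])

lemma block_words_single: "w \<in> S \<union> T \<Longrightarrow> reduced w \<Longrightarrow> w \<in> block_words S T"
  by (auto simp: block_words_def intro!: exI[of _ "[w]"])

locale complementary_letters =
  fixes X Y Z :: "'a set" and S T :: "('a \<times> bool) list set"
  assumes disj: "X \<inter> Y = {}" and sub: "X \<union> Y \<subseteq> Z"
    and S: "primitive_subgroup S (free_group X)" and T: "primitive_subgroup T (free_group Y)"
begin

lemma swap: "complementary_letters Y X Z T S"
  using disj sub S T by (simp add: complementary_letters_def Int_commute Un_commute)

lemma S_mem: "w \<in> S \<Longrightarrow> reduced w \<and> fst ` set w \<subseteq> X"
  using S subgroup.mem_carrier[of S "free_group X" w]
  by (simp add: primitive_subgroup_def mem_free_group)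

lemma T_mem: "w \<in> T \<Longrightarrow> reduced w \<and> fst ` set w \<subseteq> Y"
  using T subgroup.mem_carrier[of T "free_group Y" w]
  by (simp add: primitive_subgroup_def mem_free_group)

lemma block_words_letters: "w \<in> block_words S T \<Longrightarrow> fst ` set w \<subseteq> X \<union> Y"
  using S_mem T_mem by (fastforce simp: block_words_def)

text \<open>Each block uses a single alphabet, so a change of alphabet can only happen at the border
  of two blocks.\<close>

lemma block_words_cut:
  assumes w: "u @ v \<in> block_words S T" and uv: "u \<noteq> []" "v \<noteq> []"
    and cut: "fst (last u) \<in> X \<longleftrightarrow> fst (hd v) \<notin> X"
  shows "u \<in> block_words S T \<and> v \<in> block_words S T"
proof -
  have red: "reduced u" "reduced v" using w by (auto simp: block_words_def reduced_append_iff)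
  obtain bs where bs: "concat bs = u @ v" "set bs \<subseteq> S \<union> T"
    using w by (auto simp: block_words_def)
  then have "bs \<noteq> []" using uv by auto
  then obtain bs1 p q bs2 where b: "bs = bs1 @ (p @ q) # bs2" "u = concat bs1 @ p" "v = q @ concat bs2"
    using concat_eq_appendD[OF bs(1)] by blast
  have pq: "p @ q \<in> S \<union> T" using b(1) bs(2) by auto
  have "p = [] \<or> q = []"
  proof (rule ccontr)
    assume "\<not> (p = [] \<or> q = [])"
    then have ne: "p \<noteq> []" "q \<noteq> []" by auto
    then have "last p \<in> set (p @ q)" "hd q \<in> set (p @ q)" by auto
    moreover have "last u = last p" "hd v = hd q" using b ne by auto
    ultimately show False
      using pq S_mem[of "p @ q"] T_mem[of "p @ q"] cut disj by (auto simp: image_subset_iff)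
  qed
  then have "(\<exists>cs. u = concat cs \<and> set cs \<subseteq> S \<union> T) \<and> (\<exists>cs. v = concat cs \<and> set cs \<subseteq> S \<union> T)"
  proof
    assume "p = []"
    then show ?thesis using b bs(2) pq
      by (intro conjI exI[of _ bs1] exI[of _ "q # bs2"]) auto
  next
    assume "q = []"
    then show ?thesis using b bs(2) pq
      by (intro conjI exI[of _ "bs1 @ [p]"] exI[of _ bs2]) auto
  qed
  then show ?thesis using red by (simp add: block_words_def)
qed

lemma block_words_left:
  assumes "w \<in> block_words S T" "fst ` set w \<subseteq> X"
  shows "w \<in> S"
proof -
  interpret S: subgroup S "free_group X" using S by (simp add: primitive_subgroup_def)
  obtain bs where bs: "w = concat bs" "set bs \<subseteq> S \<union> T" "reduced w"
    using assms by (auto simp: block_words_def)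
  have "set bs \<subseteq> S \<union> T \<Longrightarrow> reduced (concat bs) \<Longrightarrow> fst ` set (concat bs) \<subseteq> X
      \<Longrightarrow> concat bs \<in> S"
  proof (induction bs)
    case Nil
    then show ?case using S.one_closed by (simp add: one_free_group)
  next
    case (Cons b bs)
    have bX: "fst ` set b \<subseteq> X" using Cons.prems by (auto simp del: set_concat)
    have "b \<in> S"
    proof (cases "b \<in> S")
      case False
      then have "b \<in> T" using Cons.prems by auto
      then have "fst ` set b \<subseteq> X \<inter> Y" using T_mem[of b] bX by auto
      then have "b = []" using disj by auto
      then show ?thesis using S.one_closed by (simp add: one_free_group)
    qed
    moreover have "concat bs \<in> S"
      using Cons by (auto simp: reduced_append_iff)
    ultimately have "b \<otimes>\<^bsub>free_group X\<^esub> concat bs \<in> S" by (rule S.m_closed)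
    then show ?case using Cons.prems by (simp add: mult_reduced)
  qed
  then show ?thesis using bs assms(2) by simp
qed

lemma block_words_restrict: "{w \<in> block_words S T. fst ` set w \<subseteq> X} = S"
  using block_words_left S_mem block_words_single[of _ S T] by blast

text \<open>Take \<open>p\<close> to be the longest suffix of \<open>u\<close> over
  \<open>X\<close>. The alphabet then changes on both sides of \<open>p d p^-1\<close>, unless
  \<open>u'\<close> is empty, and the word can be cut at both places.\<close>

lemma conj_left:
  assumes w: "u @ d @ word_inv u \<in> block_words S T" and d: "d \<noteq> []" "fst ` set d \<subseteq> X"
  obtains u' p where "u = u' @ p" "fst ` set p \<subseteq> X" "p @ d @ word_inv p \<in> S"
    "u' \<in> block_words S T" "word_inv u' \<in> block_words S T"
    "u' = [] \<or> fst (last u') \<notin> X"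
proof -
  let ?X = "\<lambda>l. fst l \<in> X"
  define p where "p = rev (takeWhile ?X (rev u))"
  define u' where "u' = rev (dropWhile ?X (rev u))"
  have u: "u = u' @ p"
    unfolding p_def u'_def by (metis rev_append rev_rev_ident takeWhile_dropWhile_id)
  have p: "fst ` set p \<subseteq> X" by (auto simp: p_def dest: set_takeWhileD)
  have u': "u' = [] \<or> fst (last u') \<notin> X"
    using hd_dropWhile[of ?X "rev u"] by (auto simp: u'_def last_rev)
  define m where "m = p @ d @ word_inv p"
  have m: "fst ` set m \<subseteq> X" "m \<noteq> []" using p d by (auto simp: m_def image_Un)
  have hdm: "fst (hd m) \<in> X" "fst (last m) \<in> X"
    using m hd_in_set[OF m(2)] last_in_set[OF m(2)] by blast+
  have w': "u' @ (m @ word_inv u') \<in> block_words S T"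
    using w by (simp add: u m_def word_inv_append)
  have "u' \<in> block_words S T \<and> word_inv u' \<in> block_words S T \<and> m \<in> block_words S T"
  proof (cases "u' = []")
    case True
    then show ?thesis using w' by simp
  next
    case False
    have 1: "u' \<in> block_words S T \<and> m @ word_inv u' \<in> block_words S T"
      using block_words_cut[OF w' False] u' False hdm m(2) by simp
    have "m \<in> block_words S T \<and> word_inv u' \<in> block_words S T"
      using block_words_cut[of m "word_inv u'"] 1 m(2) hdm False u'
      by (simp add: fst_hd_word_inv)
    with 1 show ?thesis by blast
  qed
  then show ?thesis using that[of u' p] u p u' block_words_left m(1) by (fold m_def) blast
qed

text \<open>Primitivity of \<open>S\<close> speaks only of roots over \<open>X\<close>. So the part
  \<open>u'\<close> is split off, the root is taken of the middle piece \<open>p c^n p^-1\<close>,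
  and the pieces are glued again.\<close>

lemma root_left:
  assumes t: "u @ c @ word_inv u \<in> carrier (free_group Z)" and c: "reduced (c @ c)" "c \<noteq> []"
    and n: "n \<ge> 1" and w: "u @ concat (replicate n c) @ word_inv u \<in> block_words S T"
    and cX: "fst ` set c \<subseteq> X"
  shows "u @ c @ word_inv u \<in> block_words S T"
proof -
  have ne: "concat (replicate n c) \<noteq> []" using c n by (cases n) auto
  have "fst ` set (concat (replicate n c)) \<subseteq> X" using cX by (auto simp: image_subset_iff)
  then obtain u' p where u: "u = u' @ p" and p: "fst ` set p \<subseteq> X"
    and m: "p @ concat (replicate n c) @ word_inv p \<in> S"
    and u': "u' \<in> block_words S T" "word_inv u' \<in> block_words S T" "u' = [] \<or> fst (last u') \<notin> X"
    using conj_left[OF w ne] by metis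
  have red: "reduced (u' @ (p @ c @ word_inv p) @ word_inv u')"
    using t by (simp add: mem_free_group u word_inv_append)
  then have redp: "reduced (p @ c @ word_inv p)"
    using reduced_append_iff[of u'] reduced_append_iff[of "p @ c @ word_inv p"] by blast
  have pc: "p @ c @ word_inv p \<in> carrier (free_group X)"
    using redp p cX by (auto simp: mem_free_group image_Un)
  have "(p @ c @ word_inv p) [^]\<^bsub>free_group X\<^esub> n \<in> S"
    using pow_conj_cyclically_reduced[OF pc c n] m by simp
  then have "p @ c @ word_inv p \<in> S"
    using S pc n by (simp add: primitive_subgroup_def)
  then have "p @ c @ word_inv p \<in> block_words S T"
    using redp by (simp add: block_words_single)
  moreover have "reduced ((p @ c @ word_inv p) @ word_inv u')"
    using red reduced_append_iff by blast
  ultimately have "(p @ c @ word_inv p) @ word_inv u' \<in> block_words S T"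
    using u' by (simp only: block_words_append)
  then have "u' @ (p @ c @ word_inv p) @ word_inv u' \<in> block_words S T"
    using u' red by (simp only: block_words_append)
  then show ?thesis by (simp add: u word_inv_append)
qed

text \<open>If \<open>c\<close> uses both alphabets, then \<open>c = p @ q\<close> for a change of alphabet between \<open>p\<close> and
  \<open>q\<close>. The first and the last occurrence of this change in \<open>u c\<^sup>n u\<^sup>-\<^sup>1\<close> cut off \<open>u p\<close> on the
  left and \<open>q u\<^sup>-\<^sup>1\<close> on the right.\<close>

lemma root_mixed:
  assumes t: "reduced (u @ c @ word_inv u)" and c: "reduced (c @ c)" "c \<noteq> []"
    and n: "n \<ge> 1" and w: "u @ concat (replicate n c) @ word_inv u \<in> block_words S T"
    and cX: "\<not> fst ` set c \<subseteq> X" and cY: "\<not> fst ` set c \<subseteq> Y"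
  shows "u @ c @ word_inv u \<in> block_words S T"
proof -
  have *: "(\<exists>l\<in>set w. Q l) \<Longrightarrow> (\<exists>l\<in>set w. \<not> Q l) \<Longrightarrow>
      \<exists>p q. w = p @ q \<and> p \<noteq> [] \<and> q \<noteq> [] \<and> (Q (last p) \<longleftrightarrow> \<not> Q (hd q))" for w :: "'b list" and Q
  proof (induction w)
    case (Cons l w)
    show ?case
    proof (cases "w = [] \<or> Q (hd w) \<noteq> Q l")
      case True
      then show ?thesis using Cons.prems by (intro exI[of _ "[l]"] exI[of _ w]) auto
    next
      case False
      then have "hd w \<in> set w" by auto
      then obtain p q where "w = p @ q" "p \<noteq> []" "q \<noteq> []" "Q (last p) \<longleftrightarrow> \<not> Q (hd q)"
        using Cons False by (metis set_ConsD)
      then show ?thesis by (intro exI[of _ "l # p"] exI[of _ q]) simp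
    qed
  qed simp
  \<comment> \<open>Nothing yet confines \<open>c\<close> to the two alphabets. Its power does, and
    only then does \<open>cY\<close> provide a letter in \<open>X\<close>.\<close>
  have "fst ` set (concat (replicate n c)) \<subseteq> X \<union> Y"
    using block_words_letters[OF w] by (simp add: image_Un del: set_concat)
  then have "fst ` set c \<subseteq> X \<union> Y" using n by (cases n) (auto simp del: set_concat)
  then have "(\<exists>l\<in>set c. fst l \<in> X) \<and> (\<exists>l\<in>set c. fst l \<notin> X)"
    using cX cY by blast
  then obtain p q where pq: "c = p @ q" "p \<noteq> []" "q \<noteq> []" "fst (last p) \<in> X \<longleftrightarrow> fst (hd q) \<notin> X"
    using *[of c "\<lambda>l. fst l \<in> X"] by blast
  have "u @ p \<in> block_words S T"
  proof -
    obtain m where "n = Suc m" using n by (cases n) auto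
    then have "(u @ p) @ (q @ concat (replicate m c) @ word_inv u) \<in> block_words S T"
      using w by (simp add: pq(1))
    from block_words_cut[OF this] show ?thesis using pq by simp
  qed
  moreover have "q @ word_inv u \<in> block_words S T"
  proof -
    obtain m where "n = Suc m" using n by (cases n) auto
    then have "concat (replicate n c) = concat (replicate m c) @ p @ q"
      by (simp only: concat_replicate_Suc2 pq(1))
    then have "(u @ concat (replicate m c) @ p) @ (q @ word_inv u) \<in> block_words S T"
      using w by simp
    from block_words_cut[OF this] show ?thesis using pq by simp
  qed
  ultimately have "(u @ p) @ (q @ word_inv u) \<in> block_words S T"
    using t block_words_append[of "u @ p" S T "q @ word_inv u"] by (simp add: pq(1))
  then show ?thesis by (simp add: pq(1))
qed

lemma block_words_root_closed:
  assumes t: "t \<in> carrier (free_group Z)" and n: "n \<ge> 1"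
    and tn: "t [^]\<^bsub>free_group Z\<^esub> (n::nat) \<in> block_words S T"
  shows "t \<in> block_words S T"
proof (cases "t = []")
  case False
  then obtain u c where tu: "t = u @ c @ word_inv u" and c: "c \<noteq> []" "reduced (c @ c)"
    using cyclic_reduction[of t] t by (auto simp: mem_free_group)
  have w: "u @ concat (replicate n c) @ word_inv u \<in> block_words S T"
    using pow_conj_cyclically_reduced[of u c Z n] t tn c n by (simp add: tu)
  interpret sw: complementary_letters Y X Z T S by (rule swap)
  consider "fst ` set c \<subseteq> X" | "fst ` set c \<subseteq> Y" | "\<not> fst ` set c \<subseteq> X" "\<not> fst ` set c \<subseteq> Y"
    by blast
  then show ?thesis
  proof cases
    case 1
    then show ?thesis using root_left[OF _ c(2,1) n w] t by (simp add: tu)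
  next
    case 2
    then show ?thesis using sw.root_left[OF _ c(2,1) n] w t by (simp add: tu block_words_commute)
  next
    case 3
    then show ?thesis using root_mixed[OF _ c(2,1) n w] t by (simp add: tu mem_free_group)
  qed
qed simp

end

section \<open>The abstract free product and its image\<close>

locale free_product_hom = complementary_letters X Y Z S T
  for X Y Z :: "'a set" and S T +
  fixes A B :: "'b set" and h k J :: "('b \<times> bool) list \<Rightarrow> ('a \<times> bool) list"
  assumes AB: "A \<inter> B = {}"
    and h: "h \<in> hom (free_group A) (free_group X)" "inj_on h (carrier (free_group A))"
      "S = h ` carrier (free_group A)"
    and k: "k \<in> hom (free_group B) (free_group Y)" "inj_on k (carrier (free_group B))"
      "T = k ` carrier (free_group B)"
    and J: "J \<in> hom (free_group (A \<union> B)) (free_group Z)"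
      "\<And>w. w \<in> carrier (free_group A) \<Longrightarrow> J w = h w"
      "\<And>w. w \<in> carrier (free_group B) \<Longrightarrow> J w = k w"
begin

lemma swap_hom: "free_product_hom Y X Z T S B A k h J"
  using swap AB h k J
  by (simp add: free_product_hom_def free_product_hom_axioms_def Int_commute Un_commute)

lemma group_hom_J: "group_hom (free_group (A \<union> B)) (free_group Z) J"
  unfolding group_hom_def group_hom_axioms_def by (intro conjI group_free_group J(1))

lemma J_Nil: "J [] = []"
  using hom_one[OF J(1) group_free_group group_free_group] by (simp add: one_free_group)

lemma J_eq_Nil:
  assumes "w \<in> carrier (free_group A)" "J w = []"
  shows "w = []"
  using inj_onD[OF h(2), of w "[]"] assms J(2)[of w] J(2)[of "[]"] J_Nil
  by (simp add: mem_free_group)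

text \<open>An invariant stronger than membership in the image: it also records that
  \<open>J w\<close> is nonempty and in which alphabet it starts. This is what excludes cancellation
  with a preceding syllable, and it contains injectivity.\<close>

definition good :: "('b \<times> bool) list \<Rightarrow> bool" where
  "good w \<longleftrightarrow> J w \<in> block_words S T \<and> (w \<noteq> [] \<longrightarrow> J w \<noteq> [] \<and>
     (fst (hd w) \<in> A \<longrightarrow> fst (hd (J w)) \<in> X) \<and> (fst (hd w) \<in> B \<longrightarrow> fst (hd (J w)) \<in> Y))"

lemma good_swap: "free_product_hom.good Y X T S B A J w = good w"
  by (auto simp: good_def free_product_hom.good_def[OF swap_hom] block_words_commute)

text \<open>By injectivity of \<open>h\<close> the word \<open>J u\<close> is nonempty. It ends in
  \<open>X\<close> while \<open>J v\<close> starts in \<open>Y\<close>, so the seam is reduced and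
  the product is a plain concatenation.\<close>

lemma good_left:
  assumes w: "u @ v \<in> carrier (free_group (A \<union> B))" "u \<noteq> []" "fst ` set u \<subseteq> A"
    and v: "v = [] \<or> fst (hd v) \<in> B" "good v"
  shows "good (u @ v)"
proof -
  have uA: "u \<in> carrier (free_group A)" and uv: "u \<in> carrier (free_group (A \<union> B))"
    "v \<in> carrier (free_group (A \<union> B))"
    using w by (auto simp: mem_free_group reduced_append_iff)
  have JuS: "J u \<in> S" using uA h(3) J(2) by auto
  have Ju: "reduced (J u)" "fst ` set (J u) \<subseteq> X" "J u \<noteq> []"
    using S_mem[OF JuS] J_eq_Nil[OF uA] w(2) by auto
  have Jv: "J v \<in> block_words S T" "v \<noteq> [] \<Longrightarrow> fst (hd (J v)) \<in> Y"
    "v \<noteq> [] \<Longrightarrow> J v \<noteq> []"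
    using v by (auto simp: good_def)
  have lastX: "fst (last (J u)) \<in> X" and hdX: "fst (hd (J u)) \<in> X"
    using Ju by (auto simp: image_subset_iff)
  have red: "reduced (J u @ J v)"
  proof (cases "v = []")
    case False
    then have "fst (hd (J v)) \<noteq> fst (last (J u))" using Jv lastX disj by auto
    then have "hd (J v) \<noteq> inv_letter (last (J u))" by (metis fst_inv_letter)
    then show ?thesis using Ju Jv by (simp add: reduced_append_iff block_words_def)
  qed (simp add: J_Nil Ju)
  have "J (u @ v) = J u \<otimes>\<^bsub>free_group Z\<^esub> J v"
    using hom_mult[OF J(1) uv] w(1) by (simp add: mult_reduced mem_free_group)
  also have "\<dots> = J u @ J v" using red by (rule mult_reduced)
  finally have eq: "J (u @ v) = J u @ J v" .
  have "J u @ J v \<in> block_words S T"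
    using JuS Jv(1) red Ju(1) block_words_append block_words_single by blast
  moreover have "fst (hd u) \<in> A" using w by (auto simp: image_subset_iff)
  ultimately show ?thesis
    using w(2) Ju(3) hdX AB by (auto simp: good_def eq)
qed

lemma good: "w \<in> carrier (free_group (A \<union> B)) \<Longrightarrow> good w"
proof (induction "length w" arbitrary: w rule: less_induct)
  case less
  show ?case
  proof (cases "w = []")
    case True
    then show ?thesis by (simp add: good_def J_Nil)
  next
    case False
    \<comment> \<open>\<open>Q\<close> selects the letters from the factor of the first letter, so
      \<open>u\<close> is the first syllable of the normal form in the free product, whichever
      factor it belongs to.\<close>
    define Q where "Q l \<longleftrightarrow> (fst l \<in> A \<longleftrightarrow> fst (hd w) \<in> A)" for l :: "'b \<times> bool"
    define u where "u = takeWhile Q w"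
    define v where "v = dropWhile Q w"
    have w: "w = u @ v" by (simp add: u_def v_def)
    have u: "u \<noteq> []" using False by (cases w) (auto simp: u_def Q_def)
    have uQ: "Q l" if "l \<in> set u" for l using that by (auto simp: u_def dest: set_takeWhileD)
    have vQ: "v = [] \<or> \<not> Q (hd v)" using hd_dropWhile[of Q w] by (auto simp: v_def)
    have letters: "fst ` set u \<subseteq> A \<union> B" "v = [] \<or> fst (hd v) \<in> A \<union> B"
      using less.prems w by (auto simp: mem_free_group image_subset_iff)
    have "v \<in> carrier (free_group (A \<union> B))"
      using less.prems w by (auto simp: mem_free_group reduced_append_iff)
    then have gv: "good v" using less.hyps[of v] w u by simp
    interpret sw: free_product_hom Y X Z T S B A k h J by (rule swap_hom)
    show ?thesis
    proof (cases "fst (hd w) \<in> A")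
      case True
      then have "fst ` set u \<subseteq> A" using uQ by (auto simp: Q_def)
      moreover have "v = [] \<or> fst (hd v) \<in> B" using vQ letters True by (auto simp: Q_def)
      ultimately show ?thesis using good_left[of u v] less.prems u gv by (simp add: w)
    next
      case False
      then have "fst ` set u \<subseteq> B" using uQ letters by (auto simp: Q_def)
      moreover have "v = [] \<or> fst (hd v) \<in> A" using vQ letters False by (auto simp: Q_def)
      ultimately show ?thesis using sw.good_left[of u v] less.prems u gv
        by (simp add: w good_swap Un_commute)
    qed
  qed
qed

lemma inj: "inj_on J (carrier (free_group (A \<union> B)))"
proof -
  interpret group_hom "free_group (A \<union> B)" "free_group Z" J
    by (rule group_hom_J)
  show ?thesis
    using good by (auto simp: inj_on_one_iff one_free_group good_def)
qed

lemma image: "J ` carrier (free_group (A \<union> B)) = block_words S T"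
proof
  show "J ` carrier (free_group (A \<union> B)) \<subseteq> block_words S T"
    using good by (auto simp: good_def)
next
  let ?K = "J ` carrier (free_group (A \<union> B))"
  interpret J: group_hom "free_group (A \<union> B)" "free_group Z" J
    by (rule group_hom_J)
  interpret K: subgroup ?K "free_group Z" by (rule J.img_is_subgroup)
  have block: "b \<in> ?K" if "b \<in> S \<union> T" for b
  proof -
    have "carrier (free_group A) \<union> carrier (free_group B) \<subseteq> carrier (free_group (A \<union> B))"
      by (auto simp: mem_free_group image_subset_iff)
    moreover have "S = J ` carrier (free_group A)" "T = J ` carrier (free_group B)"
      using h(3) k(3) J(2,3) by simp_all
    ultimately show ?thesis using that by blast
  qed
  have "set bs \<subseteq> S \<union> T \<Longrightarrow> reduced (concat bs) \<Longrightarrow> concat bs \<in> ?K" for bs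
  proof (induction bs)
    case Nil
    then show ?case using K.one_closed by (simp add: one_free_group)
  next
    case (Cons b bs)
    then have "b \<in> ?K" "concat bs \<in> ?K"
      using block[of b] by (simp_all add: reduced_append_iff)
    then have "b \<otimes>\<^bsub>free_group Z\<^esub> concat bs \<in> ?K" by (rule K.m_closed)
    then show ?case using Cons.prems by (simp add: mult_reduced)
  qed
  then show "block_words S T \<subseteq> ?K" by (auto simp: block_words_def)
qed

lemma primitive_image: "primitive_subgroup (J ` carrier (free_group (A \<union> B))) (free_group Z)"
proof -
  interpret J: group_hom "free_group (A \<union> B)" "free_group Z" J
    by (rule group_hom_J)
  show ?thesis
    using block_words_root_closed J.img_is_subgroup by (simp add: primitive_subgroup_def image)
qed

end

section \<open>Counting admissible representations\<close>

lemma map_cancel_cons: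
  assumes "inj_on f A" "fst l \<in> A" "fst ` set w \<subseteq> A"
  shows "map (apfst f) (cancel_cons l w) = cancel_cons (apfst f l) (map (apfst f) w)"
proof (cases w)
  case (Cons l' w')
  have "apfst f l' = inv_letter (apfst f l) \<longleftrightarrow> l' = inv_letter l"
    using assms Cons by (auto simp: inv_letter_def prod_eq_iff inj_on_def)
  then show ?thesis by (simp add: Cons cancel_cons_def)
qed (simp add: cancel_cons_def)

lemma reduced_map:
  assumes "inj_on f A"
  shows "fst ` set w \<subseteq> A \<Longrightarrow> reduced w \<Longrightarrow> reduced (map (apfst f) w)"
proof (induction w)
  case (Cons l w)
  have "cancel_cons (apfst f l) (map (apfst f) w) = map (apfst f) (l # w)"
    using map_cancel_cons[OF assms, of l w] Cons.prems by (simp add: cancel_cons_reduced)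
  then show ?case
    using reduced_cancel_cons[OF Cons.IH, of "apfst f l"] Cons.prems reduced_ConsD[of l w] by auto
qed simp

lemma map_iso_free_group:
  assumes f: "inj_on f A"
  shows "map (apfst f) \<in> iso (free_group A) (free_group (f ` A))"
proof (rule isoI)
  have "map (apfst f) (foldr cancel_cons u v)
      = foldr cancel_cons (map (apfst f) u) (map (apfst f) v)"
    if "fst ` set u \<subseteq> A" "fst ` set v \<subseteq> A" for u v
    using that(1)
  proof (induction u)
    case (Cons l u)
    have "fst ` set (foldr cancel_cons u v) \<subseteq> A"
      using foldr_letters[of u v] Cons.prems that(2) by (simp add: subset_iff) blast
    then show ?case using Cons map_cancel_cons[OF f] by simp
  qed simp
  then show "map (apfst f) \<in> hom (free_group A) (free_group (f ` A))"
    by (intro homI) (auto simp: mem_free_group mult_free_group reduced_map[OF f])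
  show "bij_betw (map (apfst f)) (carrier (free_group A)) (carrier (free_group (f ` A)))"
  proof (rule bij_betw_byWitness[where f' = "map (apfst (inv_into A f))"])
    show "\<forall>w\<in>carrier (free_group A). map (apfst (inv_into A f)) (map (apfst f) w) = w"
      using f by (fastforce simp: mem_free_group inv_into_f_f intro!: map_idI)
    show "\<forall>w\<in>carrier (free_group (f ` A)). map (apfst f) (map (apfst (inv_into A f)) w) = w"
      by (fastforce simp: mem_free_group image_subset_iff f_inv_into_f intro!: map_idI)
    show "map (apfst f) ` carrier (free_group A) \<subseteq> carrier (free_group (f ` A))"
      using reduced_map[OF f] by (fastforce simp: mem_free_group)
    show "map (apfst (inv_into A f)) ` carrier (free_group (f ` A)) \<subseteq> carrier (free_group A)"
      using reduced_map[OF inj_on_inv_into[of "f ` A" f A, OF order_refl]]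
      by (fastforce simp: mem_free_group inv_into_into)
  qed
qed

section \<open>Cardinalities in the extended naturals\<close>

lemma ecard_mono: "A \<subseteq> B \<Longrightarrow> ecard A \<le> ecard B"
  using finite_subset[of A B] by (auto simp: ecard_def card_mono)

lemma ecard_image: "inj_on f A \<Longrightarrow> ecard (f ` A) = ecard A"
  by (simp add: ecard_def card_image finite_image_iff)

lemma ecard_Times: "ecard (A \<times> B) = ecard A * ecard B"
proof (cases "A = {} \<or> B = {}")
  \<comment> \<open>The empty case is separate because the other factor may be infinite; it matches
    \<open>0 * \<infinity> = 0\<close> in \<open>enat\<close>.\<close>
  case True
  then have "ecard A = 0 \<or> ecard B = 0" by (auto simp: ecard_def zero_enat_def)
  moreover have "ecard (A \<times> B) = 0" using True by (auto simp: ecard_def zero_enat_def)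
  ultimately show ?thesis by (metis mult_zero_left mult_zero_right)
next
  case False
  then have "finite A \<Longrightarrow> card A > 0" "finite B \<Longrightarrow> card B > 0" by (auto simp: card_gt_0_iff)
  then show ?thesis using False
    by (auto simp: ecard_def finite_cartesian_product_iff card_cartesian_product)
qed

lemma ecard_le_inj_on:
  assumes "inj_on f A" "f ` A \<subseteq> B"
  shows "ecard A \<le> ecard B"
  using ecard_mono[OF assms(2)] by (simp add: ecard_image[OF assms(1)])

section \<open>Boundary words and transport of representations\<close>

lemma group_surface_group: "group (surface_group g)"
  by (simp add: surface_group_def group_free_group)

lemma surface_gens:
  "i \<in> {1..g} \<Longrightarrow> free_gen (gen_a i) \<in> carrier (surface_group g)"
  "i \<in> {1..g} \<Longrightarrow> free_gen (gen_b i) \<in> carrier (surface_group g)"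
  by (auto simp: surface_group_def intro!: free_gen_closed)

lemma (in group) commutator_closed:
  "a \<in> carrier G \<Longrightarrow> b \<in> carrier G \<Longrightarrow> commutator G a b \<in> carrier G"
  by (simp add: commutator_def)

lemma (in group) foldr_mult:
  assumes "\<And>i. i \<in> set is \<Longrightarrow> f i \<in> carrier G" "z \<in> carrier G"
  shows "foldr (\<lambda>i w. f i \<otimes> w) is \<one> \<in> carrier G"
    and "foldr (\<lambda>i w. f i \<otimes> w) is z = foldr (\<lambda>i w. f i \<otimes> w) is \<one> \<otimes> z"
proof -
  have "foldr (\<lambda>i w. f i \<otimes> w) is \<one> \<in> carrier G \<and>
      foldr (\<lambda>i w. f i \<otimes> w) is z = foldr (\<lambda>i w. f i \<otimes> w) is \<one> \<otimes> z"
    using assms by (induction "is") (auto simp: m_assoc)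
  then show "foldr (\<lambda>i w. f i \<otimes> w) is \<one> \<in> carrier G"
    "foldr (\<lambda>i w. f i \<otimes> w) is z = foldr (\<lambda>i w. f i \<otimes> w) is \<one> \<otimes> z" by auto
qed

lemma (in group_hom) hom_commutator:
  "a \<in> carrier G \<Longrightarrow> b \<in> carrier G \<Longrightarrow>
    h (commutator G a b) = commutator H (h a) (h b)"
  by (simp add: commutator_def)

lemma hom_boundary:
  assumes "group G" "h \<in> hom (surface_group g) G"
  shows "h (boundary g) = foldr (\<lambda>i w. commutator G (h (free_gen (gen_a i)))
      (h (free_gen (gen_b i))) \<otimes>\<^bsub>G\<^esub> w) [1..<Suc g] \<one>\<^bsub>G\<^esub>"
proof -
  interpret group_hom "surface_group g" G h
    using assms group_surface_group by (simp add: group_hom_def group_hom_axioms_def)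
  have "set is \<subseteq> {1..g} \<Longrightarrow>
      h (foldr (\<lambda>i w. commutator (surface_group g) (free_gen (gen_a i)) (free_gen (gen_b i))
          \<otimes>\<^bsub>surface_group g\<^esub> w) is \<one>\<^bsub>surface_group g\<^esub>)
      = foldr (\<lambda>i w. commutator G (h (free_gen (gen_a i))) (h (free_gen (gen_b i))) \<otimes>\<^bsub>G\<^esub> w) is \<one>\<^bsub>G\<^esub>"
    for "is"
  proof (induction "is")
    case (Cons i "is")
    have "foldr (\<lambda>i w. commutator (surface_group g) (free_gen (gen_a i)) (free_gen (gen_b i))
          \<otimes>\<^bsub>surface_group g\<^esub> w) is \<one>\<^bsub>surface_group g\<^esub> \<in> carrier (surface_group g)"
      by (rule G.foldr_mult(1)[OF _ G.one_closed])
        (use Cons.prems surface_gens in \<open>auto intro!: G.commutator_closed\<close>)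
    then show ?case
      using Cons surface_gens[of i g] by (simp add: hom_commutator G.commutator_closed)
  qed simp
  from this[of "[1..<Suc g]"] show ?thesis
    by (simp add: boundary_def atLeastLessThanSuc_atLeastAtMost del: upt_Suc)
qed

lemma hom_free_group_mono:
  "h \<in> hom G (free_group X) \<Longrightarrow> X \<subseteq> Z \<Longrightarrow> h \<in> hom G (free_group Z)"
  by (auto simp: hom_def mem_free_group mult_free_group Pi_def subset_iff)

lemma free_lift_cong:
  "(\<And>x. x \<in> fst ` set w \<Longrightarrow> f x = g x) \<Longrightarrow> free_lift G f w = free_lift G g w"
  by (induction w) (auto simp: free_lift_def)

text \<open>Primitivity is transitive: a root of an element of \<open>f (S)\<close> lies in the
  image of \<open>f\<close> because that image is primitive, and its preimage lies in
  \<open>S\<close> because \<open>S\<close> is primitive. Different subgroups keep different images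
  since \<open>f\<close> is injective.\<close>

lemma num_admissible_le:
  assumes G: "group G" and F: "group F" and f: "f \<in> hom G F" "inj_on f (carrier G)"
    and prim: "primitive_subgroup (f ` carrier G) F"
  shows "num_admissible G g x \<le> num_admissible F g (f x)"
proof -
  interpret f: group_hom G F f using G F f by (simp add: group_hom_def group_hom_axioms_def)
  let ?C = "carrier (surface_group g)"
  show ?thesis unfolding num_admissible_def
  proof (rule ecard_le_inj_on)
    have "h ` ?C \<subseteq> carrier G" if "h \<in> admissible_reps G g x" for h
      using that by (auto simp: admissible_reps_def genus_reps_def hom_def)
    then have "{h ` ?C | h. h \<in> admissible_reps G g x} \<subseteq> Pow (carrier G)" by blast
    then show "inj_on ((`) f) {h ` ?C | h. h \<in> admissible_reps G g x}"
      using inj_on_image_Pow[OF f(2)] inj_on_subset by blast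
    have "f \<circ> h \<in> admissible_reps F g (f x)" if h: "h \<in> admissible_reps G g x" for h
    proof -
      have hh: "h \<in> hom (surface_group g) G" "h (boundary g) = x" "inj_on h ?C"
        and prim_h: "primitive_subgroup (h ` ?C) G"
        using h by (auto simp: admissible_reps_def genus_reps_def)
      have sub: "h ` ?C \<subseteq> carrier G" using hh by (auto simp: hom_def)
      have "t \<in> f ` h ` ?C"
        if t: "t \<in> carrier F" "n \<ge> 1" "t [^]\<^bsub>F\<^esub> n \<in> f ` h ` ?C" for t and n :: nat
      proof -
        have "t \<in> f ` carrier G" using t prim sub by (auto simp: primitive_subgroup_def)
        then obtain s where s: "s \<in> carrier G" "t = f s" by blast
        obtain w where w: "w \<in> h ` ?C" "t [^]\<^bsub>F\<^esub> n = f w" using t(3) by blast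
        have "f (s [^]\<^bsub>G\<^esub> n) = f w" using s w by (simp add: f.hom_nat_pow)
        then have "s [^]\<^bsub>G\<^esub> n = w" using f(2) s w sub by (auto simp: inj_on_def)
        then have "s \<in> h ` ?C" using prim_h s w t(2) by (auto simp: primitive_subgroup_def)
        then show ?thesis using s by blast
      qed
      moreover have "subgroup (f ` h ` ?C) F"
        using prim_h by (intro f.subgroup_img_is_subgroup) (simp add: primitive_subgroup_def)
      ultimately have "primitive_subgroup ((f \<circ> h) ` ?C) F"
        by (simp add: primitive_subgroup_def image_comp)
      moreover have "inj_on (f \<circ> h) ?C"
        using hh(3) inj_on_subset[OF f(2) sub] by (rule comp_inj_on)
      moreover have "f \<circ> h \<in> hom (surface_group g) F"
        using hh(1) f(1) by (rule Group.hom_compose)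
      ultimately show ?thesis
        using hh(2) by (simp add: admissible_reps_def genus_reps_def)
    qed
    then show "(`) f ` {h ` ?C | h. h \<in> admissible_reps G g x}
        \<subseteq> {h ` ?C | h. h \<in> admissible_reps F g (f x)}"
      by (clarsimp simp only: image_comp) blast
  qed
qed

lemma subgroup_carrier_primitive: "group G \<Longrightarrow> primitive_subgroup (carrier G) G"
  by (simp add: primitive_subgroup_def group.subgroup_self)

lemma num_admissible_iso:
  assumes "group G" "group F" "f \<in> iso G F"
  shows "num_admissible G g x \<le> num_admissible F g (f x)"
  using assms subgroup_carrier_primitive[OF assms(2)]
  by (intro num_admissible_le) (auto simp: iso_def bij_betw_def)

lemma sup_admissible_is_iso:
  assumes "group G" "group F" "G \<cong> F"
  shows "sup_admissible G g \<le> sup_admissible F g"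
proof -
  obtain f where f: "f \<in> iso G F" using assms(3) by (auto simp: is_iso_def)
  then have "f x \<in> carrier F" if "x \<in> carrier G" for x
    using that by (auto simp: iso_def hom_def)
  then show ?thesis
    unfolding sup_admissible_def using num_admissible_iso[OF assms(1,2) f]
    by (intro SUP_mono) blast
qed

text \<open>Renumbers the last \<open>n\<close> of \<open>m + n\<close> handles as
  \<open>1..n\<close>. On their indices, all above \<open>m\<close>, the subtraction is not
  truncated.\<close>

definition lower_gen :: "nat \<Rightarrow> surface_gen \<Rightarrow> surface_gen" where
  "lower_gen m s = (case s of gen_a i \<Rightarrow> gen_a (i - m) | gen_b i \<Rightarrow> gen_b (i - m))"

lemma inj_on_lower_gen: "inj_on (lower_gen m) (gen_a ` {Suc m..m + n} \<union> gen_b ` {Suc m..m + n})"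
  by (auto simp: inj_on_def lower_gen_def)

lemma lower_gen_image:
  "lower_gen m ` (gen_a ` {Suc m..m + n} \<union> gen_b ` {Suc m..m + n})
    = gen_a ` {1..n} \<union> gen_b ` {1..n}"
proof -
  have "(\<lambda>i. i - m) ` {Suc m..m + n} = {1..n}"
    by (auto simp: image_iff intro!: bexI[of _ "_ + m"])
  moreover have "lower_gen m ` gen_a ` I = gen_a ` (\<lambda>i. i - m) ` I"
    "lower_gen m ` gen_b ` I = gen_b ` (\<lambda>i. i - m) ` I" for I
    by (auto simp: lower_gen_def image_image)
  ultimately show ?thesis by (simp add: image_Un)
qed

lemma boundary_closed: "boundary g \<in> carrier (surface_group g)"
proof -
  interpret group "surface_group g" by (rule group_surface_group)
  show ?thesis unfolding boundary_def
    by (rule foldr_mult(1)[OF _ one_closed])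
      (use surface_gens in \<open>auto intro!: commutator_closed simp del: upt_Suc\<close>)
qed

lemma foldr_cong_mem:
  "(\<And>x z. x \<in> set xs \<Longrightarrow> f x z = g x z) \<Longrightarrow> foldr f xs z = foldr g xs z"
  by (induction xs) auto

text \<open>The algebra of joining surfaces: \<open>A\<close> holds the first \<open>m\<close>
  handles and \<open>B\<close> the last \<open>n\<close>. The universal property glues
  \<open>h\<close> and the renumbered \<open>k\<close>, and the boundary word of genus
  \<open>m + n\<close> splits into the first \<open>m\<close> commutators followed by the other
  \<open>n\<close>.\<close>

lemma admissible_product:
  assumes XY: "X \<inter> Y = {}" "X \<union> Y \<subseteq> Z"
    and h: "h \<in> admissible_reps (free_group X) m x"
    and k: "k \<in> admissible_reps (free_group Y) n y"
  obtains J where "J \<in> admissible_reps (free_group Z) (m + n) (x \<otimes>\<^bsub>free_group Z\<^esub> y)"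
    "J ` carrier (surface_group (m + n))
      = block_words (h ` carrier (surface_group m)) (k ` carrier (surface_group n))"
proof -
  interpret FZ: group "free_group Z" by (rule group_free_group)
  define A where "A = gen_a ` {1..m} \<union> gen_b ` {1..m}"
  define B where "B = gen_a ` {Suc m..m + n} \<union> gen_b ` {Suc m..m + n}"
  let ?S = "h ` carrier (surface_group m)" and ?T = "k ` carrier (surface_group n)"
  have sA: "surface_group m = free_group A" by (simp add: A_def surface_group_def)
  have "{1..m + n} = {1..m} \<union> {Suc m..m + n}" by auto
  then have sAB: "surface_group (m + n) = free_group (A \<union> B)"
    by (simp add: A_def B_def surface_group_def image_Un Un_ac)
  have AB: "A \<inter> B = {}" by (auto simp: A_def B_def)
  have hh: "h \<in> hom (free_group A) (free_group X)" "inj_on h (carrier (free_group A))"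
      "h (boundary m) = x" "primitive_subgroup ?S (free_group X)"
    using h by (auto simp: admissible_reps_def genus_reps_def sA)
  have kk: "k \<in> hom (surface_group n) (free_group Y)" "inj_on k (carrier (surface_group n))"
      "k (boundary n) = y" "primitive_subgroup ?T (free_group Y)"
    using k by (auto simp: admissible_reps_def genus_reps_def)
  let ?l = "map (apfst (lower_gen m)) :: (surface_gen \<times> bool) list \<Rightarrow> _"
  have "?l \<in> iso (free_group B) (surface_group n)"
    using map_iso_free_group[OF inj_on_lower_gen[of m n, folded B_def]]
    by (simp add: surface_group_def lower_gen_image B_def)
  then have l: "?l \<in> hom (free_group B) (surface_group n)" "inj_on ?l (carrier (free_group B))"
      "?l ` carrier (free_group B) = carrier (surface_group n)"
    by (auto simp: iso_def bij_betw_def)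
  define k' where "k' = k \<circ> ?l"
  have k': "k' \<in> hom (free_group B) (free_group Y)" "inj_on k' (carrier (free_group B))"
      "?T = k' ` carrier (free_group B)"
    unfolding k'_def using Group.hom_compose[OF l(1) kk(1)] comp_inj_on[OF l(2)] l(3) kk(2)
    by (simp_all only: image_comp[symmetric])
  have hZ: "h \<in> hom (free_group A) (free_group Z)" and kZ: "k \<in> hom (surface_group n) (free_group Z)"
    and k'Z: "k' \<in> hom (free_group B) (free_group Z)"
    using hh(1) kk(1) k'(1) XY(2) by (auto elim: hom_free_group_mono)
  define f where "f s = (if s \<in> A then h (free_gen s) else k' (free_gen s))" for s
  define J where "J = free_lift (free_group Z) f"
  have "f ` (A \<union> B) \<subseteq> carrier (free_group Z)"
    using hom_in_carrier[OF hZ free_gen_closed] hom_in_carrier[OF k'Z free_gen_closed]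
    by (auto simp: f_def)
  then have J: "J \<in> hom (free_group (A \<union> B)) (free_group Z)"
    unfolding J_def by (rule FZ.free_lift_hom)
  have JA: "J w = h w" if "w \<in> carrier (free_group A)" for w
    unfolding J_def FZ.free_hom_unique[OF hZ that]
    using that by (intro free_lift_cong) (auto simp: f_def mem_free_group)
  have JB: "J w = k' w" if "w \<in> carrier (free_group B)" for w
    unfolding J_def FZ.free_hom_unique[OF k'Z that]
    using that AB by (intro free_lift_cong) (auto simp: f_def mem_free_group)
  interpret P: free_product_hom X Y Z ?S ?T A B h k' J
    using XY hh(4) kk(4) AB hh(1,2) k' J JA JB by unfold_locales (simp_all add: sA)
  let ?c = "\<lambda>h i. commutator (free_group Z) (h (free_gen (gen_a i))) (h (free_gen (gen_b i)))"
  let ?F = "\<lambda>h is. foldr (\<lambda>i w. ?c h i \<otimes>\<^bsub>free_group Z\<^esub> w) is"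
  have cJ: "?c J i = ?c h i" if "i \<in> {1..m}" for i
    using surface_gens[OF that, unfolded sA] by (simp add: JA)
  have cJ': "?c J (i + m) = ?c k i" if "i \<in> {1..n}" for i
  proof -
    have "gen_a (i + m) \<in> B" "gen_b (i + m) \<in> B" using that by (auto simp: B_def)
    note this[THEN free_gen_closed, THEN JB]
    then show ?thesis by (simp add: k'_def free_gen_def lower_gen_def)
  qed
  have "map (\<lambda>i. i + m) [1..<Suc n] = [Suc m..<Suc m + n]"
    by (rule nth_equalityI) (auto simp del: upt_Suc)
  then have "[1..<Suc (m + n)] = [1..<Suc m] @ map (\<lambda>i. i + m) [1..<Suc n]"
    using upt_add_eq_append[of 1 "Suc m" n] by (simp del: upt_Suc)
  then have "J (boundary (m + n)) = ?F J [1..<Suc m] (?F J (map (\<lambda>i. i + m) [1..<Suc n]) \<one>\<^bsub>free_group Z\<^esub>)"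
    using hom_boundary[OF group_free_group, of J "m + n" Z] J by (simp add: sAB del: upt_Suc)
  also have "?F J (map (\<lambda>i. i + m) [1..<Suc n]) \<one>\<^bsub>free_group Z\<^esub> = ?F k [1..<Suc n] \<one>\<^bsub>free_group Z\<^esub>"
    unfolding foldr_map o_def by (rule foldr_cong_mem) (use cJ' in \<open>simp add: atLeastLessThanSuc_atLeastAtMost del: upt_Suc\<close>)
  also have "\<dots> = y"
    using hom_boundary[OF group_free_group kZ] kk(3) by simp
  also have "?F J [1..<Suc m] y = ?F h [1..<Suc m] y"
    by (rule foldr_cong_mem) (use cJ in \<open>simp add: atLeastLessThanSuc_atLeastAtMost del: upt_Suc\<close>)
  also have "\<dots> = ?F h [1..<Suc m] \<one>\<^bsub>free_group Z\<^esub> \<otimes>\<^bsub>free_group Z\<^esub> y"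
  proof (rule FZ.foldr_mult(2))
    show "?c h i \<in> carrier (free_group Z)" if "i \<in> set [1..<Suc m]" for i
      using that hom_in_carrier[OF hZ] surface_gens[of i m]
      by (intro FZ.commutator_closed) (auto simp: sA atLeastLessThanSuc_atLeastAtMost simp del: upt_Suc)
    show "y \<in> carrier (free_group Z)"
      using hom_in_carrier[OF kZ boundary_closed] kk(3) by simp
  qed
  also have "?F h [1..<Suc m] \<one>\<^bsub>free_group Z\<^esub> = x"
    using hom_boundary[OF group_free_group, of h m Z] hZ hh(3) by (simp add: sA)
  finally have "J (boundary (m + n)) = x \<otimes>\<^bsub>free_group Z\<^esub> y" .
  then have "J \<in> admissible_reps (free_group Z) (m + n) (x \<otimes>\<^bsub>free_group Z\<^esub> y)"
    using J P.inj P.primitive_image by (simp add: admissible_reps_def genus_reps_def sAB)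
  then show ?thesis using that[of J] P.image by (simp add: sAB)
qed

lemma num_admissible_mult:
  assumes XY: "X \<inter> Y = {}" "X \<union> Y \<subseteq> Z"
  shows "num_admissible (free_group X) m x * num_admissible (free_group Y) n y
    \<le> num_admissible (free_group Z) (m + n) (x \<otimes>\<^bsub>free_group Z\<^esub> y)"
proof -
  let ?A = "{h ` carrier (surface_group m) | h. h \<in> admissible_reps (free_group X) m x}"
  let ?B = "{k ` carrier (surface_group n) | k. k \<in> admissible_reps (free_group Y) n y}"
  have restrict: "{w \<in> block_words S T. fst ` set w \<subseteq> X} = S \<and>
      {w \<in> block_words S T. fst ` set w \<subseteq> Y} = T" if "S \<in> ?A" "T \<in> ?B" for S T
  proof -
    have "primitive_subgroup S (free_group X)" "primitive_subgroup T (free_group Y)"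
      using that unfolding admissible_reps_def by blast+
    then interpret complementary_letters X Y Z S T
      using XY by (simp add: complementary_letters_def)
    interpret sw: complementary_letters Y X Z T S by (rule swap)
    show ?thesis
      using block_words_restrict sw.block_words_restrict by (simp add: block_words_commute[of T S])
  qed
  have "inj_on (\<lambda>(S, T). block_words S T) (?A \<times> ?B)"
  proof (rule inj_onI)
    fix p q
    assume p: "p \<in> ?A \<times> ?B" and q: "q \<in> ?A \<times> ?B"
      and eq: "(\<lambda>(S, T). block_words S T) p = (\<lambda>(S, T). block_words S T) q"
    obtain S T S' T' where pq: "p = (S, T)" "q = (S', T')" by (cases p, cases q) blast
    have *: "block_words S T = block_words S' T'" using eq by (simp add: pq)
    have "S \<in> ?A" "T \<in> ?B" "S' \<in> ?A" "T' \<in> ?B"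
      using p q by (simp_all only: pq mem_Times_iff fst_conv snd_conv)
    then have "S = S'" "T = T'"
      using restrict[of S T] restrict[of S' T'] unfolding * by simp_all
    then show "p = q" by (simp add: pq)
  qed
  moreover have "(\<lambda>(S, T). block_words S T) ` (?A \<times> ?B)
      \<subseteq> {J ` carrier (surface_group (m + n)) | J.
          J \<in> admissible_reps (free_group Z) (m + n) (x \<otimes>\<^bsub>free_group Z\<^esub> y)}"
  proof (rule image_subsetI)
    fix p assume "p \<in> ?A \<times> ?B"
    then obtain h k where p: "p = (h ` carrier (surface_group m), k ` carrier (surface_group n))"
      and hk: "h \<in> admissible_reps (free_group X) m x" "k \<in> admissible_reps (free_group Y) n y"
      by blast
    obtain J where "J \<in> admissible_reps (free_group Z) (m + n) (x \<otimes>\<^bsub>free_group Z\<^esub> y)"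
      "J ` carrier (surface_group (m + n))
        = block_words (h ` carrier (surface_group m)) (k ` carrier (surface_group n))"
      using admissible_product[OF XY hk] by blast
    then show "(\<lambda>(S, T). block_words S T) p \<in> {J ` carrier (surface_group (m + n)) | J.
        J \<in> admissible_reps (free_group Z) (m + n) (x \<otimes>\<^bsub>free_group Z\<^esub> y)}"
      unfolding p prod.case mem_Collect_eq by metis
  qed
  ultimately show ?thesis
    unfolding num_admissible_def ecard_Times[symmetric] by (rule ecard_le_inj_on)
qed

text \<open>If \<open>c\<close> is finite and neither supremum is \<open>0\<close>, then a nonzero
  value on one side bounds the other side by \<open>c\<close>. A bounded set in \<open>enat\<close>
  is finite, so both suprema are attained and the hypothesis applies to the two maximisers.\<close>

lemma SUP_mult_le_enat:
  fixes f g :: "'a \<Rightarrow> enat"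
  assumes "\<And>x y. x \<in> A \<Longrightarrow> y \<in> B \<Longrightarrow> f x * g y \<le> c"
  shows "(SUP x\<in>A. f x) * (SUP y\<in>B. g y) \<le> c"
proof (cases "(SUP x\<in>A. f x) = 0 \<or> (SUP y\<in>B. g y) = 0 \<or> c = \<infinity>")
  case False
  then obtain x0 y0 where x0: "x0 \<in> A" "f x0 \<noteq> 0" and y0: "y0 \<in> B" "g y0 \<noteq> 0"
    by (metis SUP_bot_conv(1) bot_enat_def)
  have le: "a \<le> a * b" "a \<le> b * a" if "b \<noteq> 0" for a b :: enat
  proof -
    have "1 \<le> b" using ileI1[of 0 b] that by (simp add: one_eSuc)
    then show "a \<le> a * b" "a \<le> b * a"
      using mult_left_mono[of 1 b a] mult_right_mono[of 1 b a] by simp_all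
  qed
  have "f x \<le> c" if "x \<in> A" for x
    using le(1)[OF y0(2), of "f x"] assms[OF that y0(1)] by (rule order_trans)
  then have sf: "(SUP x\<in>A. f x) \<le> c" by (rule SUP_least)
  have "g y \<le> c" if "y \<in> B" for y
    using le(2)[OF x0(2), of "g y"] assms[OF x0(1) that] by (rule order_trans)
  then have sg: "(SUP y\<in>B. g y) \<le> c" by (rule SUP_least)
  have attained: "Sup C \<in> C" if "C \<noteq> {}" "Sup C \<le> c" for C :: "enat set"
  proof -
    obtain N where N: "c = enat N" using False by auto
    have "y \<le> enat N" if "y \<in> C" for y
      using order_trans[OF Sup_upper[OF that] \<open>Sup C \<le> c\<close>] by (simp add: N)
    then have "finite C" by (rule finite_enat_bounded)
    then show ?thesis using that(1) by (simp add: Sup_enat_def)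
  qed
  obtain x where x: "x \<in> A" "(SUP x\<in>A. f x) = f x"
    using attained[OF _ sf] x0(1) by auto
  obtain y where y: "y \<in> B" "(SUP y\<in>B. g y) = g y"
    using attained[OF _ sg] y0(1) by auto
  show ?thesis using assms[OF x(1) y(1)] x(2) y(2) by simp
qed auto

section \<open>Folded graphs with output\<close>

fun run_word :: "('s \<Rightarrow> 'l \<Rightarrow> 's option) \<Rightarrow> 's \<Rightarrow> 'l list \<Rightarrow> 's option" where
  "run_word tr s [] = Some s"
| "run_word tr s (l # w) = (case tr s l of None \<Rightarrow> None | Some s' \<Rightarrow> run_word tr s' w)"

text \<open>Rewriting in the style of Reidemeister and Schreier: the product of the edge outputs
  along a path. It is meaningful only where \<open>run_word\<close> succeeds, since
  \<open>the\<close> is applied to a possibly missing edge.\<close>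

fun dec_word ::
  "('s \<Rightarrow> 'l \<Rightarrow> 's option) \<Rightarrow> ('s \<Rightarrow> 'l \<Rightarrow> ('c \<times> bool) list) \<Rightarrow> 's \<Rightarrow> 'l list \<Rightarrow> ('c \<times> bool) list"
where
  "dec_word tr out s [] = []"
| "dec_word tr out s (l # w) = foldr cancel_cons (out s l) (dec_word tr out (the (tr s l)) w)"

text \<open>Foldedness is hidden in the types: \<open>tr\<close> is a function, so no two edges with
  the same label leave a vertex, and by \<open>tr_inv\<close> no two enter one. Inverse edges carry
  inverse outputs, which makes the output of a path invariant under free reduction.\<close>

locale folded_graph =
  fixes tr :: "'s \<Rightarrow> 'a \<times> bool \<Rightarrow> 's option" and out :: "'s \<Rightarrow> 'a \<times> bool \<Rightarrow> ('c \<times> bool) list"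
    and base :: 's and X :: "'a set" and C :: "'c set"
  assumes tr_inv: "tr s l = Some s' \<Longrightarrow> tr s' (inv_letter l) = Some s"
    and out_inv: "tr s l = Some s' \<Longrightarrow> out s' (inv_letter l) = word_inv (out s l)"
    and out_closed: "tr s l = Some s' \<Longrightarrow> fst l \<in> X \<Longrightarrow> out s l \<in> carrier (free_group C)"
begin

abbreviation run :: "'s \<Rightarrow> ('a \<times> bool) list \<Rightarrow> 's option" where
  "run \<equiv> run_word tr"

abbreviation dec :: "'s \<Rightarrow> ('a \<times> bool) list \<Rightarrow> ('c \<times> bool) list" where
  "dec \<equiv> dec_word tr out"

lemma run_append: "run s (u @ v) = (case run s u of None \<Rightarrow> None | Some p \<Rightarrow> run p v)"
  by (induction u arbitrary: s) (auto split: option.splits)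

lemma run_word_inv: "run s w = Some p \<Longrightarrow> run p (word_inv w) = Some s"
  by (induction w arbitrary: s)
    (auto simp: word_inv_def run_append tr_inv split: option.splits)

lemma dec_closed: "run s w = Some p \<Longrightarrow> fst ` set w \<subseteq> X \<Longrightarrow> dec s w \<in> carrier (free_group C)"
proof (induction w arbitrary: s)
  case (Cons l w)
  then obtain s' where s': "tr s l = Some s'" "run s' w = Some p" by (auto split: option.splits)
  then show ?case
    using Cons monoid.m_closed[OF group.is_monoid[OF group_free_group], OF out_closed[OF s'(1)]]
    by (simp add: mult_free_group)
qed (simp add: mem_free_group)

lemma cancel_cons_run:
  assumes "tr s l = Some s'" "run s' w = Some p" "fst l \<in> X" "fst ` set w \<subseteq> X"
  shows "run s (cancel_cons l w) = Some p \<and>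
    dec s (cancel_cons l w) = foldr cancel_cons (out s l) (dec s' w)"
proof (cases "\<exists>w'. w = inv_letter l # w'")
  case True
  then obtain w' where w: "w = inv_letter l # w'" by blast
  have tr': "tr s' (inv_letter l) = Some s" using assms(1) by (rule tr_inv)
  have o: "out s l \<in> carrier (free_group C)" using out_closed assms by blast
  have run: "run s w' = Some p" using assms(2) by (simp add: w tr')
  have d: "dec s w' \<in> carrier (free_group C)" using dec_closed[OF run] assms(4) by (simp add: w)
  interpret group "free_group C" by (rule group_free_group)
  have "out s l \<otimes>\<^bsub>free_group C\<^esub> (inv\<^bsub>free_group C\<^esub> out s l \<otimes>\<^bsub>free_group C\<^esub> dec s w') = dec s w'"
    using o d by (simp flip: m_assoc)
  then show ?thesis
    using run by (simp add: w cancel_cons_def tr' out_inv[OF assms(1)] inv_free_group[OF o] mult_free_group)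
next
  case False
  then have "cancel_cons l w = l # w" by (cases w) (auto simp: cancel_cons_def)
  then show ?thesis using assms by simp
qed

lemma mult_run:
  assumes "run s u = Some p" "run p v = Some q" "fst ` set u \<subseteq> X" "fst ` set v \<subseteq> X"
  shows "run s (foldr cancel_cons u v) = Some q \<and>
    dec s (foldr cancel_cons u v) = foldr cancel_cons (dec s u) (dec p v)"
  using assms
proof (induction u arbitrary: s)
  case (Cons l u)
  then obtain s' where s': "tr s l = Some s'" "run s' u = Some p" by (auto split: option.splits)
  have IH: "run s' (foldr cancel_cons u v) = Some q"
    "dec s' (foldr cancel_cons u v) = foldr cancel_cons (dec s' u) (dec p v)"
    using Cons s' by auto
  have "fst ` set (foldr cancel_cons u v) \<subseteq> X"
    using foldr_letters[of u v] Cons.prems by (simp add: subset_iff) blast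
  then show ?case
    using cancel_cons_run[OF s'(1) IH(1)] Cons.prems IH(2) s'(1) dec_closed[OF Cons.prems(2,4)]
    by (simp add: foldr_assoc mem_free_group)
qed simp

definition loops :: "('a \<times> bool) list set" where
  "loops = {w \<in> carrier (free_group X). run base w = Some base}"

lemma subgroup_loops: "subgroup loops (free_group X)"
proof -
  interpret group "free_group X" by (rule group_free_group)
  show ?thesis
  proof (rule subgroupI)
    show "loops \<subseteq> carrier (free_group X)" by (auto simp: loops_def)
    have "[] \<in> loops" by (simp add: loops_def mem_free_group)
    then show "loops \<noteq> {}" by blast
    show "inv\<^bsub>free_group X\<^esub> w \<in> loops" if "w \<in> loops" for w
      using that run_word_inv[of base w base] inv_closed[of w]
      by (auto simp: loops_def inv_free_group)
    show "u \<otimes>\<^bsub>free_group X\<^esub> v \<in> loops" if "u \<in> loops" "v \<in> loops" for u v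
      using that mult_run[of base u base v base] m_closed[of u v]
      by (simp add: loops_def mem_free_group mult_free_group)
  qed
qed

text \<open>If \<open>u\<close> leads from the base to \<open>p\<close>, then
  \<open>u c^n u^-1\<close> is a loop at the base exactly when \<open>c^n\<close> is a loop at
  \<open>p\<close>. Closure under roots thus concerns only cyclically reduced words, but at every
  vertex.\<close>

lemma primitive_loops:
  assumes R: "\<And>p c n. reduced (c @ c) \<Longrightarrow> c \<noteq> [] \<Longrightarrow> fst ` set c \<subseteq> X \<Longrightarrow> n \<ge> 1 \<Longrightarrow>
    run p (concat (replicate n c)) = Some p \<Longrightarrow> run p c = Some p"
  shows "primitive_subgroup loops (free_group X)"
proof -
  have "t \<in> loops" if t: "t \<in> carrier (free_group X)" and n: "n \<ge> 1"
    and tn: "t [^]\<^bsub>free_group X\<^esub> (n::nat) \<in> loops" for t n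
  proof (cases "t = []")
    case True
    then show ?thesis using t by (simp add: loops_def)
  next
    case False
    then obtain u c where tu: "t = u @ c @ word_inv u" and c: "c \<noteq> []" "reduced (c @ c)"
      using cyclic_reduction[of t] t by (auto simp: mem_free_group)
    have "run base (u @ concat (replicate n c) @ word_inv u) = Some base"
      using pow_conj_cyclically_reduced[of u c X n] t tn c n by (simp add: tu loops_def)
    then obtain p q where p: "run base u = Some p" and pq: "run p (concat (replicate n c)) = Some q"
      and q: "run q (word_inv u) = Some base"
      by (auto simp: run_append split: option.splits)
    \<comment> \<open>Reversing the path of \<open>word_inv u\<close> reads \<open>u\<close> from
      the base, so determinism identifies its end with \<open>p\<close>.\<close>
    have "q = p" using run_word_inv[OF q] p by simp
    then have "run p c = Some p"
      using R[OF c(2,1) _ n] pq t by (auto simp: tu mem_free_group)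
    then show ?thesis using t p run_word_inv[OF p] by (simp add: loops_def tu run_append)
  qed
  then show ?thesis using subgroup_loops by (simp add: primitive_subgroup_def)
qed

text \<open>Let \<open>q\<close> be the vertex reached from \<open>p\<close> by \<open>c\<close>.
  Since powers of \<open>c\<close> can be read from \<open>p\<close> indefinitely, the same long
  power can be read from both \<open>p\<close> and \<open>q\<close>. Its first \<open>N\<close>
  letters then force \<open>p = q\<close>.\<close>

lemma primitive_loops_synchronizing:
  assumes sync: "\<And>p q w. reduced w \<Longrightarrow> length w = N \<Longrightarrow> run p w \<noteq> None \<Longrightarrow> run q w \<noteq> None \<Longrightarrow> p = q"
  shows "primitive_subgroup loops (free_group X)"
proof (rule primitive_loops)
  fix p c n
  assume c: "reduced (c @ c)" "c \<noteq> []" and n: "n \<ge> (1::nat)"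
    and cyc: "run p (concat (replicate n c)) = Some p"
  have run_k: "run p (concat (replicate (k * n) c)) = Some p" for k
    by (induction k) (simp_all add: cyc run_append replicate_add)
  define W where "W = concat (replicate (N * n) c)"
  have len: "length W = N * n * length c"
    by (simp add: W_def length_concat sum_list_replicate)
  have "n * length c \<ge> 1" using c(2) n by (cases c) auto
  then have "length W \<ge> N" unfolding len mult.assoc by (metis mult.right_neutral mult_le_mono2)
  \<comment> \<open>Here \<open>m = n - 1\<close>: the power \<open>(N + 1) n\<close> leaves one
    \<open>c\<close> in front of \<open>W\<close> and \<open>m\<close> copies behind it.\<close>
  obtain m where m: "Suc N * n = Suc (N * n + m)" using n by (cases n) auto
  have "run p (c @ W @ concat (replicate m c)) = Some p"
    using run_k[of "Suc N"] unfolding m by (simp add: W_def replicate_add)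
  then obtain q where q: "run p c = Some q" and qW: "run q W \<noteq> None"
    by (auto simp: run_append split: option.splits)
  define w where "w = take N W"
  have W: "W = w @ drop N W" by (simp add: w_def)
  have prefix: "run s W \<noteq> None \<Longrightarrow> run s w \<noteq> None" for s
    by (subst (asm) W) (auto simp: run_append split: option.splits)
  have "run p W \<noteq> None" using run_k[of N] by (simp add: W_def)
  moreover have "reduced w"
    using reduced_concat_replicate[OF c(1), of "N * n"] W by (metis W_def reduced_append_iff)
  moreover have "length w = N" using \<open>length W \<ge> N\<close> by (simp add: w_def)
  ultimately have "p = q" using sync prefix qW by blast
  then show "run p c = Some p" using q by simp
qed

end

text \<open>The word \<open>tau s\<close> leads from the base vertex to \<open>s\<close>. It is read off a spanning tree on which
  \<open>out\<close> is trivial, and \<open>f\<close> lists the loops that close up the remaining edges.\<close>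

locale folded_graph_basis = folded_graph tr out base X C
  for tr :: "'s \<Rightarrow> 'a \<times> bool \<Rightarrow> 's option" and out :: "'s \<Rightarrow> 'a \<times> bool \<Rightarrow> ('c \<times> bool) list"
    and base X C +
  fixes tau :: "'s \<Rightarrow> ('a \<times> bool) list" and f :: "'c \<Rightarrow> ('a \<times> bool) list"
  assumes f_closed: "c \<in> C \<Longrightarrow> f c \<in> carrier (free_group X)"
    and run_f: "c \<in> C \<Longrightarrow> run base (f c) = Some base"
    and dec_f: "c \<in> C \<Longrightarrow> dec base (f c) = [(c, True)]"
    and tau_closed: "tau s \<in> carrier (free_group X)" and tau_base: "tau base = []"
    and tau_step: "tr s l = Some s' \<Longrightarrow> fst l \<in> X \<Longrightarrow>
      tau s \<otimes>\<^bsub>free_group X\<^esub> [l] =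
      free_lift (free_group X) f (out s l) \<otimes>\<^bsub>free_group X\<^esub> tau s'"
begin

definition psi :: "('c \<times> bool) list \<Rightarrow> ('a \<times> bool) list" where
  "psi = free_lift (free_group X) f"

lemma psi_hom: "psi \<in> hom (free_group C) (free_group X)"
  unfolding psi_def using f_closed by (intro group.free_lift_hom[OF group_free_group]) auto

lemma psi_closed: "w \<in> carrier (free_group C) \<Longrightarrow> psi w \<in> carrier (free_group X)"
  using psi_hom by (auto simp: hom_def)

text \<open>Reading off outputs is a left inverse of \<open>psi\<close>; hence the loops
  \<open>f c\<close> are free generators of their span.\<close>

lemma dec_psi:
  "w \<in> carrier (free_group C) \<Longrightarrow> run base (psi w) = Some base \<and> dec base (psi w) = w"
proof (induction w)
  case Nil
  then show ?case by (simp add: psi_def free_lift_def one_free_group)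
next
  case (Cons l w)
  have red: "reduced (l # w)" and lC: "fst l \<in> C" and w: "w \<in> carrier (free_group C)"
    using Cons.prems reduced_ConsD[of l w] by (simp_all add: mem_free_group)
  define g where "g = (if snd l then f (fst l) else inv\<^bsub>free_group X\<^esub> f (fst l))"
  have fl: "f (fst l) \<in> carrier (free_group X)" using f_closed lC by blast
  have inv_loop: "run base (word_inv (f (fst l))) = Some base"
    using run_word_inv[OF run_f[OF lC]] .
  \<comment> \<open>By multiplicativity of outputs, since a loop followed by its inverse reduces to
    the empty word.\<close>
  have "dec base (word_inv (f (fst l))) = [(fst l, False)]"
  proof -
    interpret group "free_group C" by (rule group_free_group)
    have a: "[(fst l, True)] \<in> carrier (free_group C)"
      using lC by (simp add: mem_free_group reduced_def)
    have "foldr cancel_cons (word_inv (f (fst l))) (f (fst l)) = []"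
      by (simp add: word_inv_def foldr_inverse)
    then have "dec base (word_inv (f (fst l))) \<otimes>\<^bsub>free_group C\<^esub> [(fst l, True)] = \<one>\<^bsub>free_group C\<^esub>"
      using mult_run[OF inv_loop run_f[OF lC]] fl dec_f[OF lC]
      by (simp add: mem_free_group mult_free_group one_free_group)
    moreover have "dec base (word_inv (f (fst l))) \<in> carrier (free_group C)"
      using dec_closed[OF inv_loop] fl by (simp add: mem_free_group)
    ultimately have "inv\<^bsub>free_group C\<^esub> [(fst l, True)] = dec base (word_inv (f (fst l)))"
      using a by (intro inv_equality)
    then show ?thesis using inv_free_group[OF a] by (simp add: word_inv_def inv_letter_def)
  qed
  then have g: "g \<in> carrier (free_group X)" "run base g = Some base" "dec base g = [l]"
    using fl inv_loop run_f[OF lC] dec_f[OF lC] group.inv_closed[OF group_free_group fl]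
    by (cases l; auto simp: g_def inv_free_group)+
  have "psi (l # w) = foldr cancel_cons g (psi w)"
    by (simp add: psi_def free_lift_def g_def mult_free_group)
  then show ?case
    using mult_run[OF g(2), of "psi w" base] Cons.IH[OF w] g psi_closed[OF w] red
    by (simp add: mem_free_group cancel_cons_reduced)
qed

lemma psi_inj: "inj_on psi (carrier (free_group C))"
  using dec_psi by (metis inj_on_inverseI)

text \<open>\<open>tau_step\<close> telescopes along the path. For a loop at the base both
  \<open>tau\<close> terms vanish, so the loop is \<open>psi\<close> of its output and lies in the
  span of the generators. The word need not be reduced; \<open>foldr cancel_cons w []\<close> is the
  element it represents.\<close>

lemma psi_dec:
  assumes "run s w = Some p" "fst ` set w \<subseteq> X"
  shows "foldr cancel_cons (tau s) (foldr cancel_cons w []) = foldr cancel_cons (psi (dec s w)) (tau p)"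
  using assms
proof (induction w arbitrary: s)
  case Nil
  then show ?case using tau_closed[of p]
    by (simp add: psi_def free_lift_def one_free_group mem_free_group foldr_Nil)
next
  case (Cons l w)
  interpret group "free_group X" by (rule group_free_group)
  interpret psi: group_hom "free_group C" "free_group X" psi
    using psi_hom unfolding group_hom_def group_hom_axioms_def by (intro conjI group_free_group)
  let ?m = "\<lambda>u v. u \<otimes>\<^bsub>free_group X\<^esub> v"
  obtain s' where s': "tr s l = Some s'" "run s' w = Some p"
    using Cons.prems by (auto split: option.splits)
  have lX: "fst l \<in> X" and wX: "fst ` set w \<subseteq> X" using Cons.prems by auto
  define v where "v = foldr cancel_cons w []"
  have v: "v \<in> carrier (free_group X)"
    using wX foldr_letters[of w "[]"] reduced_foldr[of "[]" w] by (auto simp: v_def mem_free_group)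
  have l: "[l] \<in> carrier (free_group X)" using lX by (simp add: mem_free_group reduced_def)
  have o: "out s l \<in> carrier (free_group C)" using out_closed[OF s'(1) lX] .
  have d: "dec s' w \<in> carrier (free_group C)" using dec_closed[OF s'(2) wX] .
  have IH: "?m (tau s') v = ?m (psi (dec s' w)) (tau p)"
    using Cons.IH[OF s'(2) wX] by (simp add: v_def mult_free_group)
  have "?m (tau s) (?m [l] v) = ?m (?m (tau s) [l]) v"
    using tau_closed l v by (simp add: m_assoc)
  also have "\<dots> = ?m (psi (out s l)) (?m (tau s') v)"
    using tau_step[OF s'(1) lX] tau_closed v psi_closed[OF o] by (simp add: psi_def[symmetric] m_assoc)
  also have "\<dots> = ?m (psi (out s l \<otimes>\<^bsub>free_group C\<^esub> dec s' w)) (tau p)"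
    using o d tau_closed psi_closed by (simp add: IH m_assoc)
  finally show ?case by (simp add: mult_free_group v_def s'(1))
qed

lemma psi_image: "psi ` carrier (free_group C) = loops"
proof
  show "psi ` carrier (free_group C) \<subseteq> loops"
    using psi_closed dec_psi by (auto simp: loops_def)
  show "loops \<subseteq> psi ` carrier (free_group C)"
  proof
    fix w assume "w \<in> loops"
    then have w: "reduced w" "fst ` set w \<subseteq> X" "run base w = Some base"
      by (auto simp: loops_def mem_free_group)
    have d: "dec base w \<in> carrier (free_group C)" using dec_closed[OF w(3,2)] .
    then have "reduced (psi (dec base w))" using psi_closed by (simp add: mem_free_group)
    then have "w = psi (dec base w)"
      using psi_dec[OF w(3,2)] w(1) by (simp add: tau_base foldr_Nil)
    then show "w \<in> psi ` carrier (free_group C)" using d by blast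
  qed
qed

end

section \<open>The kernel of an exponent sum\<close>

text \<open>The infinite cyclic cover: the kernel of the exponent sum of the generator \<open>0\<close> is free on the
  conjugates of the generators \<open>j > 0\<close> by the powers \<open>0\<^sup>s\<close>.\<close>

definition cover_tr :: "int \<Rightarrow> nat \<times> bool \<Rightarrow> int option" where
  "cover_tr s l = Some (if fst l = 0 then if snd l then s + 1 else s - 1 else s)"

text \<open>The edges labelled \<open>0\<close> form a line through all vertices, which is the
  spanning tree and has no output. The remaining edges are loops, and the loop labelled
  \<open>j\<close> at \<open>s\<close> is the basis element \<open>(j, s)\<close>.\<close>

definition cover_out :: "int \<Rightarrow> nat \<times> bool \<Rightarrow> ((nat \<times> int) \<times> bool) list" where
  "cover_out s l = (if fst l = 0 then [] else [((fst l, s), snd l)])"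

lemma cover_out_0: "cover_out s (0, b) = []"
  by (simp add: cover_out_def)

definition cover_tau :: "nat \<Rightarrow> int \<Rightarrow> (nat \<times> bool) list" where
  "cover_tau r s = free_gen 0 [^]\<^bsub>free_group {..<r}\<^esub> s"

definition cover_gen :: "nat \<Rightarrow> nat \<times> int \<Rightarrow> (nat \<times> bool) list" where
  "cover_gen r c = cover_tau r (snd c) \<otimes>\<^bsub>free_group {..<r}\<^esub> free_gen (fst c)
     \<otimes>\<^bsub>free_group {..<r}\<^esub> inv\<^bsub>free_group {..<r}\<^esub> cover_tau r (snd c)"

lemma folded_graph_cover: "folded_graph cover_tr cover_out {..<r} ({1..<r} \<times> UNIV)"
  by unfold_locales
    (auto simp: cover_tr_def cover_out_def word_inv_def inv_letter_def mem_free_group reduced_def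
      split: if_splits)

lemma run_cover:
  "run_word cover_tr s w
    = Some (s + (\<Sum>l\<leftarrow>w. if fst l = 0 then if snd l then 1 else - 1 else 0))"
  by (induction w arbitrary: s) (auto simp: cover_tr_def)

context
  fixes r :: nat
  assumes r: "r \<ge> 1"
begin

interpretation cover: folded_graph cover_tr cover_out 0 "{..<r}" "{1..<r} \<times> UNIV"
  by (rule folded_graph_cover)

interpretation group "free_group {..<r}" by (rule group_free_group)

lemma gen0: "free_gen 0 \<in> carrier (free_group {..<r})"
  using r by (intro free_gen_closed) auto

lemma cover_tau_closed: "cover_tau r s \<in> carrier (free_group {..<r})"
  by (simp add: cover_tau_def gen0)

lemma inv_gen0: "inv\<^bsub>free_group {..<r}\<^esub> free_gen 0 = [(0, False)]"
  using r by (intro inv_free_gen) auto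

lemma cover_tau_add: "cover_tau r (s + t) = cover_tau r s \<otimes>\<^bsub>free_group {..<r}\<^esub> cover_tau r t"
  by (simp add: cover_tau_def int_pow_mult gen0)

lemma cover_tau_1: "cover_tau r 1 = [(0, True)]"
  using gen0 by (simp add: cover_tau_def) (simp add: free_gen_def)

lemma cover_tau_minus: "cover_tau r (- s) = inv\<^bsub>free_group {..<r}\<^esub> cover_tau r s"
  by (simp add: cover_tau_def int_pow_neg gen0)

lemma cover_tau_minus_1: "cover_tau r (- 1) = [(0, False)]"
  using inv_gen0 gen0 by (simp add: cover_tau_def int_pow_neg)

lemma run_cover_tau:
  "run_word cover_tr s (cover_tau r k) = Some (s + k) \<and> dec_word cover_tr cover_out s (cover_tau r k) = []"
proof (induction k rule: int_induct[where k = 0])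
  case base
  then show ?case by (simp add: cover_tau_def one_free_group)
next
  case (step1 k)
  have "run_word cover_tr (s + k) [(0, True)] = Some (s + (k + 1))" by (simp add: cover_tr_def)
  then show ?case
    using cover.mult_run[of s "cover_tau r k" "s + k" "[(0, True)]"] step1 cover_tau_closed[of k] r
    by (simp add: cover_tau_add cover_tau_1 mult_free_group mem_free_group cover_out_0)
next
  case (step2 k)
  have "run_word cover_tr (s + k) [(0, False)] = Some (s + (k - 1))" by (simp add: cover_tr_def)
  then show ?case
    using cover.mult_run[of s "cover_tau r k" "s + k" "[(0, False)]"] step2 cover_tau_closed[of k] r
      cover_tau_add[of k "- 1"]
    by (simp add: cover_tau_minus_1 mult_free_group mem_free_group cover_out_0)
qed

lemma cover_gen_closed: "c \<in> {1..<r} \<times> UNIV \<Longrightarrow> cover_gen r c \<in> carrier (free_group {..<r})"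
  by (auto simp: cover_gen_def cover_tau_closed intro!: m_closed inv_closed free_gen_closed)

lemma run_cover_gen:
  assumes "c \<in> {1..<r} \<times> UNIV"
  shows "run_word cover_tr 0 (cover_gen r c) = Some 0 \<and>
    dec_word cover_tr cover_out 0 (cover_gen r c) = [(c, True)]"
proof -
  obtain j s where c: "c = (j, s)" "j \<noteq> 0" "j < r" using assms by (cases c) auto
  have j: "run_word cover_tr s (free_gen j) = Some s"
    "dec_word cover_tr cover_out s (free_gen j) = [(c, True)]" "fst ` set (free_gen j) \<subseteq> {..<r}"
    using c by (auto simp: free_gen_def cover_tr_def cover_out_def cancel_cons_def)
  have jc: "free_gen j \<in> carrier (free_group {..<r})" using c(3) by (intro free_gen_closed) auto
  let ?u = "cover_tau r s \<otimes>\<^bsub>free_group {..<r}\<^esub> free_gen j"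
  have u: "run_word cover_tr 0 ?u = Some s" "dec_word cover_tr cover_out 0 ?u = [(c, True)]"
    using cover.mult_run[of 0 "cover_tau r s" s "free_gen j"] run_cover_tau[of 0 s] j
      cover_tau_closed[of s] by (simp_all add: mult_free_group mem_free_group)
  have "?u \<in> carrier (free_group {..<r})" using cover_tau_closed jc by (rule m_closed)
  then have "run_word cover_tr 0 (?u \<otimes>\<^bsub>free_group {..<r}\<^esub> cover_tau r (- s)) = Some 0 \<and>
    dec_word cover_tr cover_out 0 (?u \<otimes>\<^bsub>free_group {..<r}\<^esub> cover_tau r (- s)) = [(c, True)]"
    using cover.mult_run[OF u(1), of "cover_tau r (- s)" 0] run_cover_tau[of s "- s"] u(2)
      cover_tau_closed[of "- s"] by (simp add: mult_free_group mem_free_group cancel_cons_def)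
  then show ?thesis by (simp add: cover_gen_def c cover_tau_minus)
qed

interpretation cover: folded_graph_basis cover_tr cover_out 0 "{..<r}" "{1..<r} \<times> UNIV"
  "cover_tau r" "cover_gen r"
proof
  fix s l s' assume tr: "cover_tr s l = Some s'" and l: "fst l \<in> {..<r}"
  show "cover_tau r s \<otimes>\<^bsub>free_group {..<r}\<^esub> [l] =
      free_lift (free_group {..<r}) (cover_gen r) (cover_out s l) \<otimes>\<^bsub>free_group {..<r}\<^esub> cover_tau r s'"
  proof (cases "fst l = 0")
    case True
    show ?thesis
    proof (cases "snd l")
      case snd: True
      then have "l = (0, True)" using True by (simp add: prod_eq_iff)
      then show ?thesis using tr cover_tau_closed
        by (auto simp: cover_tr_def cover_out_def free_lift_def cover_tau_add cover_tau_1)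
    next
      case False
      then have l0: "l = (0, False)" using True by (simp add: prod_eq_iff)
      then have "cover_tau r s' = cover_tau r s \<otimes>\<^bsub>free_group {..<r}\<^esub> [l]"
        using tr cover_tau_add[of s "- 1"] by (simp add: cover_tr_def cover_tau_minus_1)
      then show ?thesis using cover_tau_closed[of s']
        by (simp add: l0 cover_out_0 free_lift_def)
    qed
  next
    case False
    then have c: "(fst l, s) \<in> {1..<r} \<times> UNIV" using l by auto
    have g: "free_gen (fst l) \<in> carrier (free_group {..<r})" using l by (rule free_gen_closed)
    have s': "s' = s" using tr False by (simp add: cover_tr_def)
    have "[l] = (if snd l then free_gen (fst l) else inv\<^bsub>free_group {..<r}\<^esub> free_gen (fst l))"
      using l by (cases l) (auto simp: inv_free_gen, auto simp: free_gen_def)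
    moreover have "free_lift (free_group {..<r}) (cover_gen r) (cover_out s l)
      = (if snd l then cover_gen r (fst l, s) else inv\<^bsub>free_group {..<r}\<^esub> cover_gen r (fst l, s))"
      using False cover_gen_closed[OF c] by (simp add: cover_out_def free_lift_def)
    ultimately show ?thesis
      using g cover_tau_closed[of s] by (simp add: s' cover_gen_def inv_mult_group m_assoc)
  qed
qed (auto simp: cover_gen_closed run_cover_gen cover_tau_closed, simp add: cover_tau_def one_free_group)

lemma primitive_cover: "primitive_subgroup cover.loops (free_group {..<r})"
proof (rule cover.primitive_loops)
  fix p c n
  assume n: "n \<ge> (1::nat)" and run: "run_word cover_tr p (concat (replicate n c)) = Some p"
  define z :: "nat \<times> bool \<Rightarrow> int" where "z l = (if fst l = 0 then if snd l then 1 else - 1 else 0)" for l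
  have "(\<Sum>l\<leftarrow>concat (replicate n c). z l) = int n * (\<Sum>l\<leftarrow>c. z l)"
    by (induction n) (simp_all add: algebra_simps)
  then show "run_word cover_tr p c = Some p"
    using run n by (simp add: run_cover z_def[abs_def])
qed

lemma num_admissible_cover:
  assumes "x \<in> carrier (free_group ({1..<r} \<times> (UNIV :: int set)))"
  shows "num_admissible (free_group ({1..<r} \<times> (UNIV :: int set))) g x
    \<le> sup_admissible (free_group {..<r}) g"
proof -
  have "num_admissible (free_group ({1..<r} \<times> UNIV)) g x \<le> num_admissible (free_group {..<r}) g (cover.psi x)"
    using primitive_cover
    by (intro num_admissible_le group_free_group cover.psi_hom cover.psi_inj) (simp only: cover.psi_image)
  also have "\<dots> \<le> sup_admissible (free_group {..<r}) g"
    unfolding sup_admissible_def using cover.psi_closed[OF assms] by (rule SUP_upper)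
  finally show ?thesis .
qed

end

lemma sup_admissible_mult:
  fixes r :: nat
  assumes "r \<ge> 2"
  shows "sup_admissible (free_group {..<r}) m * sup_admissible (free_group {..<r}) n
    \<le> sup_admissible (free_group {..<r}) (m + n)"
  unfolding sup_admissible_def[of _ m] sup_admissible_def[of _ n]
proof (rule SUP_mult_le_enat)
  fix x y assume x: "x \<in> carrier (free_group {..<r})" and y: "y \<in> carrier (free_group {..<r})"
  \<comment> \<open>Two disjoint copies of the \<open>r\<close> letters among the conjugates of
    generator \<open>1\<close>: nonnegative exponents for one, negative exponents for the other.
    Generator \<open>1\<close> exists because \<open>r \<ge> 2\<close>.\<close>
  define i j where "i k = (1::nat, int k)" and "j k = (1::nat, - 1 - int k)" for k :: nat
  have ij: "inj_on i {..<r}" "inj_on j {..<r}" "i ` {..<r} \<inter> j ` {..<r} = {}"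
    "i ` {..<r} \<union> j ` {..<r} \<subseteq> {1..<r} \<times> UNIV"
    using assms by (auto simp: i_def j_def inj_on_def)
  let ?X = "free_group (i ` {..<r})" and ?Y = "free_group (j ` {..<r})"
    and ?Z = "free_group ({1..<r} \<times> (UNIV :: int set))"
  define x' y' where "x' = map (apfst i) x" and "y' = map (apfst j) y"
  have "x' \<in> carrier ?X" "y' \<in> carrier ?Y"
    using x y map_iso_free_group[OF ij(1)] map_iso_free_group[OF ij(2)]
    by (auto simp: x'_def y'_def iso_def hom_def)
  then have "x' \<in> carrier ?Z" "y' \<in> carrier ?Z" using ij(4) unfolding mem_free_group by blast+
  then have xy: "x' \<otimes>\<^bsub>?Z\<^esub> y' \<in> carrier ?Z"
    by (intro monoid.m_closed[OF group.is_monoid[OF group_free_group]])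
  have "num_admissible (free_group {..<r}) m x * num_admissible (free_group {..<r}) n y
      \<le> num_admissible ?X m x' * num_admissible ?Y n y'"
    unfolding x'_def y'_def
    by (intro mult_mono num_admissible_iso group_free_group map_iso_free_group ij) simp_all
  also have "\<dots> \<le> num_admissible ?Z (m + n) (x' \<otimes>\<^bsub>?Z\<^esub> y')"
    using ij(3,4) by (rule num_admissible_mult)
  also have "\<dots> \<le> sup_admissible (free_group {..<r}) (m + n)"
    using assms xy by (intro num_admissible_cover) auto
  finally show "num_admissible (free_group {..<r}) m x * num_admissible (free_group {..<r}) n y
      \<le> sup_admissible (free_group {..<r}) (m + n)" .
qed

section \<open>Genus one\<close>

text \<open>An entry \<open>((s, l), (t, v))\<close> is an edge from \<open>s\<close> to \<open>t\<close> with label \<open>l\<close> and output \<open>v\<close>; every edge is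
  listed together with its inverse. Below, \<open>0\<close> is the base vertex, and the letters \<open>a\<close>, \<open>b\<close> are the
  generators \<open>0\<close>, \<open>1\<close>.\<close>

type_synonym edge_table =
  "((nat \<times> (nat \<times> bool)) \<times> (nat \<times> (surface_gen \<times> bool) list)) list"

definition table_tr :: "edge_table \<Rightarrow> nat \<Rightarrow> nat \<times> bool \<Rightarrow> nat option" where
  "table_tr es s l = map_option fst (map_of es (s, l))"

definition table_out :: "edge_table \<Rightarrow> nat \<Rightarrow> nat \<times> bool \<Rightarrow> (surface_gen \<times> bool) list" where
  "table_out es s l = (case map_of es (s, l) of None \<Rightarrow> [] | Some e \<Rightarrow> snd e)"

text \<open>An evaluable form of \<open>free_lift\<close> into a free group: the group inverse, a
  description, is replaced by \<open>word_inv\<close>.\<close>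

definition subst_word :: "('c \<Rightarrow> ('a \<times> bool) list) \<Rightarrow> ('c \<times> bool) list \<Rightarrow> ('a \<times> bool) list" where
  "subst_word f w =
     foldr (\<lambda>l. foldr cancel_cons (if snd l then f (fst l) else word_inv (f (fst l)))) w []"

lemma free_lift_subst_word:
  assumes "\<And>c. c \<in> fst ` set w \<Longrightarrow> f c \<in> carrier (free_group X)"
  shows "free_lift (free_group X) f w = subst_word f w"
  using assms
  by (induction w) (simp_all add: free_lift_def subst_word_def mult_free_group one_free_group inv_free_group)

definition pair_gen :: "'a \<Rightarrow> 'a \<Rightarrow> surface_gen \<Rightarrow> 'a" where
  "pair_gen u v c = (case c of gen_a _ \<Rightarrow> u | gen_b _ \<Rightarrow> v)"

text \<open>The default \<open>[]\<close> matters because \<open>tau_closed\<close> is demanded of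
  every natural number, not only of the vertices of the table.\<close>

definition nth_word :: "('a \<times> bool) list list \<Rightarrow> nat \<Rightarrow> ('a \<times> bool) list" where
  "nth_word ts s = (if s < length ts then ts ! s else [])"

definition letters2 :: "(nat \<times> bool) list" where
  "letters2 = [(0, True), (0, False), (1, True), (1, False)]"

definition gens1 :: "surface_gen list" where
  "gens1 = [gen_a 1, gen_b 1]"

text \<open>The assumptions of \<open>folded_graph_basis\<close> as a finite computation. Only the
  letters \<open>0\<close> and \<open>1\<close> occur and the rank is not mentioned, so one
  evaluation serves every \<open>r \<ge> 2\<close>.\<close>

definition table_ok ::
  "edge_table \<Rightarrow> (nat \<times> bool) list list \<Rightarrow> (nat \<times> bool) list \<Rightarrow> (nat \<times> bool) list \<Rightarrow> bool" where
  "table_ok es ts u v \<longleftrightarrow>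
     (\<forall>((s, l), (t, w)) \<in> set es.
        s < length ts \<and> fst l < 2 \<and> map_of es (t, inv_letter l) = Some (s, word_inv w) \<and>
        reduced w \<and> fst ` set w \<subseteq> set gens1 \<and>
        foldr cancel_cons (nth_word ts s) [l]
          = foldr cancel_cons (subst_word (pair_gen u v) w) (nth_word ts t)) \<and>
     (\<forall>w \<in> set (u # v # ts). reduced w \<and> fst ` set w \<subseteq> {0, 1}) \<and>
     nth_word ts 0 = [] \<and>
     (\<forall>c \<in> set gens1. run_word (table_tr es) 0 (pair_gen u v c) = Some 0 \<and>
        dec_word (table_tr es) (table_out es) 0 (pair_gen u v c) = [(c, True)])"

text \<open>Only reduced words can be tested: a word such as \<open>a a^-1 a a^-1\<close> is
  readable from every vertex with an outgoing edge \<open>a\<close>.\<close>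

definition table_synchronizing :: "edge_table \<Rightarrow> nat \<Rightarrow> bool" where
  "table_synchronizing es k \<longleftrightarrow>
     (\<forall>w \<in> set (filter reduced (List.n_lists 4 letters2)).
        length (filter (\<lambda>p. run_word (table_tr es) p w \<noteq> None) [0..<k]) \<le> 1)"

lemma table_tr_SomeD:
  assumes "table_tr es s l = Some t"
  shows "((s, l), (t, table_out es s l)) \<in> set es"
proof -
  obtain w where "map_of es (s, l) = Some (t, w)"
    using assms by (auto simp: table_tr_def)
  then show ?thesis using map_of_SomeD[of es "(s, l)" "(t, w)"] by (simp add: table_out_def)
qed

lemma table_okD:
  assumes "table_ok es ts u v" "table_tr es s l = Some t"
  defines "w \<equiv> table_out es s l"
  shows "s < length ts" "fst l < 2" "map_of es (t, inv_letter l) = Some (s, word_inv w)"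
    "reduced w" "fst ` set w \<subseteq> set gens1"
    "foldr cancel_cons (nth_word ts s) [l]
      = foldr cancel_cons (subst_word (pair_gen u v) w) (nth_word ts t)"
  using assms(1) table_tr_SomeD[OF assms(2)] unfolding table_ok_def w_def by fast+

text \<open>The finite enumeration covers all words and vertices, because a run stops at any letter
  or starting state that does not occur in the table.\<close>

lemma synchronizing:
  assumes ok: "table_ok es ts u v" and sync: "table_synchronizing es (length ts)"
    and w: "reduced w" "length w = 4"
    and p: "run_word (table_tr es) p w \<noteq> None" and q: "run_word (table_tr es) q w \<noteq> None"
  shows "p = q"
proof -
  have "set w \<subseteq> set letters2" if "run_word (table_tr es) p w \<noteq> None" for p w
    using that
  proof (induction w arbitrary: p)
    case (Cons l w)
    then obtain t where t: "table_tr es p l = Some t" "run_word (table_tr es) t w \<noteq> None"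
      by (auto split: option.splits)
    have "fst l < 2" using table_okD(2)[OF ok t(1)] .
    then have "l \<in> set letters2" by (cases l) (auto simp: letters2_def less_2_cases_iff)
    then show ?case using Cons.IH[OF t(2)] by simp
  qed simp
  then have "w \<in> set (filter reduced (List.n_lists 4 letters2))"
    using w p by (simp add: set_n_lists)
  then have le: "length (filter (\<lambda>p. run_word (table_tr es) p w \<noteq> None) [0..<length ts]) \<le> 1"
    using sync unfolding table_synchronizing_def by blast
  have "p < length ts" if "run_word (table_tr es) p w \<noteq> None" for p
    using that w(2) table_okD(1)[OF ok, of p] by (cases w) (auto split: option.splits)
  then have pq: "{p, q} \<subseteq> set (filter (\<lambda>p. run_word (table_tr es) p w \<noteq> None) [0..<length ts])"
    using p q by simp
  have "card {p, q} \<le> 1"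
    using order_trans[OF card_mono[OF _ pq] order_trans[OF card_length le]] by simp
  then show "p = q" by (cases "p = q") simp_all
qed

lemma table_folded_graph:
  assumes ok: "table_ok es ts u v" and r: "r \<ge> 2"
  shows "folded_graph_basis (table_tr es) (table_out es) 0 {..<r} (set gens1) (nth_word ts) (pair_gen u v)"
proof -
  note parts = ok[unfolded table_ok_def, THEN conjunct2, THEN conjunct1]
    ok[unfolded table_ok_def, THEN conjunct2, THEN conjunct2, THEN conjunct1]
    ok[unfolded table_ok_def, THEN conjunct2, THEN conjunct2, THEN conjunct2]
  have words: "w \<in> carrier (free_group {..<r})" if "w \<in> set (u # v # ts)" for w
  proof -
    have "reduced w" "fst ` set w \<subseteq> {0, 1}" using bspec[OF parts(1) that] by simp_all
    moreover have "{0, 1} \<subseteq> {..<r}" using r by auto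
    ultimately show ?thesis unfolding mem_free_group by (metis order_trans)
  qed
  have pair: "pair_gen u v c \<in> carrier (free_group {..<r})" for c
    using words by (simp add: pair_gen_def split: surface_gen.split)
  note D = table_okD[OF ok]
  show ?thesis
  proof unfold_locales
    fix s l t assume tr: "table_tr es s l = Some t"
    show "table_tr es t (inv_letter l) = Some s" "table_out es t (inv_letter l) = word_inv (table_out es s l)"
      using D(3)[OF tr] by (simp_all add: table_tr_def table_out_def)
    show "table_out es s l \<in> carrier (free_group (set gens1))"
      using D(4,5)[OF tr] by (simp add: mem_free_group)
    show "nth_word ts s \<otimes>\<^bsub>free_group {..<r}\<^esub> [l]
        = free_lift (free_group {..<r}) (pair_gen u v) (table_out es s l) \<otimes>\<^bsub>free_group {..<r}\<^esub> nth_word ts t"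
      using D(6)[OF tr] by (simp add: free_lift_subst_word[OF pair] mult_free_group)
  next
    fix s show "nth_word ts s \<in> carrier (free_group {..<r})"
      using words[of "ts ! s"] by (simp add: nth_word_def mem_free_group)
  next
    show "nth_word ts 0 = []" by (rule parts(2))
  next
    fix c assume "c \<in> set gens1"
    then show "run_word (table_tr es) 0 (pair_gen u v c) = Some 0"
      "dec_word (table_tr es) (table_out es) 0 (pair_gen u v c) = [(c, True)]"
      using bspec[OF parts(3)] by simp_all
  qed (rule pair)
qed

lemma table_admissible:
  assumes ok: "table_ok es ts u v" and sync: "table_synchronizing es (length ts)" and r: "r \<ge> 2"
  shows "{w \<in> carrier (free_group {..<r}). run_word (table_tr es) 0 w = Some 0}
    \<in> {h ` carrier (surface_group 1) | h.
        h \<in> admissible_reps (free_group {..<r}) 1 (commutator (free_group {..<r}) u v)}"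
proof -
  interpret folded_graph_basis "table_tr es" "table_out es" 0 "{..<r}" "set gens1" "nth_word ts" "pair_gen u v"
    using ok r by (rule table_folded_graph)
  interpret group "free_group {..<r}" by (rule group_free_group)
  have sg: "surface_group 1 = free_group (set gens1)"
    by (simp add: surface_group_def gens1_def insert_commute)
  have psi_gen: "psi (free_gen c) = pair_gen u v c" if "c \<in> set gens1" for c
    unfolding psi_def using f_closed[OF that] by (rule free_lift_gen)
  have g: "gen_a 1 \<in> set gens1" "gen_b 1 \<in> set gens1" by (simp_all add: gens1_def)
  have uv: "u \<in> carrier (free_group {..<r})" "v \<in> carrier (free_group {..<r})"
    using f_closed[OF g(1)] f_closed[OF g(2)] by (simp_all add: pair_gen_def)
  have "[1..<Suc 1] = [1]" by simp
  then have "psi (boundary 1) = commutator (free_group {..<r}) u v"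
    using hom_boundary[OF group_free_group, of psi 1 "{..<r}", unfolded sg, OF psi_hom] psi_gen[OF g(1)] psi_gen[OF g(2)] uv
    by (simp add: pair_gen_def commutator_closed del: upt_Suc)
  moreover have "primitive_subgroup loops (free_group {..<r})"
    using synchronizing[OF ok sync] by (rule primitive_loops_synchronizing)
  ultimately have "psi \<in> admissible_reps (free_group {..<r}) 1 (commutator (free_group {..<r}) u v)"
    unfolding admissible_reps_def genus_reps_def sg using psi_hom psi_inj by (simp add: psi_image)
  moreover have "psi ` carrier (surface_group 1) = loops" by (simp only: sg psi_image)
  ultimately show ?thesis unfolding loops_def by blast
qed

text \<open>The cycles of \<open>u_A\<close> and \<open>v_A\<close> at \<open>0\<close>, with the
  first edge of \<open>u_A\<close> folded onto the last edge of \<open>v_A\<close>. Five vertices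
  and six edges up to inversion leave two edges outside the spanning tree, one for each
  generator.\<close>

definition edges_A :: edge_table where
  "edges_A = [((0, (0, True)), (3, [])), ((3, (0, False)), (0, [])),
          ((3, (1, True)), (1, [])), ((1, (1, False)), (3, [])),
          ((2, (0, True)), (0, [])), ((0, (0, False)), (2, [])),
          ((2, (1, True)), (4, [])), ((4, (1, False)), (2, [])),
          ((1, (1, True)), (0, [(gen_a 1, True)])), ((0, (1, False)), (1, [(gen_a 1, False)])),
          ((4, (0, False)), (3, [(gen_b 1, True)])), ((3, (0, True)), (4, [(gen_b 1, False)]))]"

definition tree_A :: "(nat \<times> bool) list list" where
  "tree_A = [[], [(0, True), (1, True)], [(0, False)], [(0, True)], [(0, False), (1, True)]]"

definition u_A :: "(nat \<times> bool) list" where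
  "u_A = [(0, True), (1, True), (1, True)]"

definition v_A :: "(nat \<times> bool) list" where
  "v_A = [(0, False), (1, True), (0, False), (0, False)]"

text \<open>The edge from \<open>4\<close> to \<open>2\<close> closes up to the loop \<open>v_B u_B\<close>, hence its output has length two.\<close>

definition edges_B :: edge_table where
  "edges_B = [((0, (0, True)), (2, [])), ((2, (0, False)), (0, [])),
          ((1, (0, True)), (0, [])), ((0, (0, False)), (1, [])),
          ((1, (1, True)), (3, [])), ((3, (1, False)), (1, [])),
          ((4, (0, True)), (3, [])), ((3, (0, False)), (4, [])),
          ((1, (1, False)), (2, [(gen_b 1, True)])), ((2, (1, True)), (1, [(gen_b 1, False)])),
          ((4, (1, True)), (2, [(gen_b 1, True), (gen_a 1, True)])),
          ((2, (1, False)), (4, [(gen_a 1, False), (gen_b 1, False)]))]"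

definition tree_B :: "(nat \<times> bool) list list" where
  "tree_B = [[], [(0, False)], [(0, True)], [(0, False), (1, True)], [(0, False), (1, True), (0, False)]]"

definition u_B :: "(nat \<times> bool) list" where
  "u_B = [(0, True), (1, True), (1, True), (0, False), (1, True), (0, False)]"

definition v_B :: "(nat \<times> bool) list" where
  "v_B = [(0, False), (1, False), (0, False)]"

lemma table_ok_A: "table_ok edges_A tree_A u_A v_A"
  by code_simp

lemma table_ok_B: "table_ok edges_B tree_B u_B v_B"
  by code_simp

lemma synchronizing_A: "table_synchronizing edges_A 5"
  by code_simp

lemma synchronizing_B: "table_synchronizing edges_B 5"
  by code_simp

text \<open>Both sides reduce to the word \<open>a b^2 a^-1 b a^-2 b^-2 a b^-1 a\<close> of length
  twelve.\<close>

lemma commutators_eq: "foldr cancel_cons u_A (foldr cancel_cons v_A (foldr cancel_cons (word_inv u_A) (word_inv v_A)))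
   = foldr cancel_cons u_B (foldr cancel_cons v_B (foldr cancel_cons (word_inv u_B) (word_inv v_B)))"
  by code_simp

lemma two_le_sup_admissible:
  assumes r: "r \<ge> (2::nat)"
  shows "2 \<le> sup_admissible (free_group {..<r}) 1"
proof -
  interpret group "free_group {..<r}" by (rule group_free_group)
  define x where "x = commutator (free_group {..<r}) u_A v_A"
  have "{u_A, v_A, u_B, v_B} \<subseteq> carrier (free_group {..<r})"
    using r by (auto simp: mem_free_group u_A_def v_A_def u_B_def v_B_def reduced_def inv_letter_def)
  then have c: "u_A \<in> carrier (free_group {..<r})" "v_A \<in> carrier (free_group {..<r})"
    "u_B \<in> carrier (free_group {..<r})" "v_B \<in> carrier (free_group {..<r})" by simp_all
  have comm: "commutator (free_group {..<r}) u v
      = foldr cancel_cons u (foldr cancel_cons v (foldr cancel_cons (word_inv u) (word_inv v)))"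
    if "u \<in> carrier (free_group {..<r})" "v \<in> carrier (free_group {..<r})" for u v
  proof -
    have "commutator (free_group {..<r}) u v = u \<otimes>\<^bsub>free_group {..<r}\<^esub> (v \<otimes>\<^bsub>free_group {..<r}\<^esub>
        (inv\<^bsub>free_group {..<r}\<^esub> u \<otimes>\<^bsub>free_group {..<r}\<^esub> inv\<^bsub>free_group {..<r}\<^esub> v))"
      using that by (simp add: commutator_def m_assoc)
    then show ?thesis using that by (simp add: inv_free_group mult_free_group)
  qed
  have x2: "x = commutator (free_group {..<r}) u_B v_B"
    using commutators_eq by (simp add: x_def comm c)
  let ?L = "\<lambda>es. {w \<in> carrier (free_group {..<r}). run_word (table_tr es) 0 w = Some 0}"
  let ?A = "{h ` carrier (surface_group 1) | h. h \<in> admissible_reps (free_group {..<r}) 1 x}"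
  have "length tree_A = 5" "length tree_B = 5" by (simp_all add: tree_A_def tree_B_def)
  then have "?L edges_A \<in> ?A" "?L edges_B \<in> ?A"
    using table_admissible[OF table_ok_A _ r] synchronizing_A table_admissible[OF table_ok_B _ r] synchronizing_B
    unfolding x2[symmetric] x_def[symmetric] by simp_all
  then have sub: "{?L edges_A, ?L edges_B} \<subseteq> ?A" by blast
  \<comment> \<open>This is the inverse of \<open>v_B\<close>. In the first graph it leads along
    \<open>0, 3, 1\<close> and stops there, as no edge \<open>a\<close> leaves
    \<open>1\<close>.\<close>
  let ?w = "[(0, True), (1, True), (0, True)] :: (nat \<times> bool) list"
  have "?w \<in> carrier (free_group {..<r})"
    using r by (simp add: mem_free_group reduced_def inv_letter_def)
  then have "?w \<in> ?L edges_B" "?w \<notin> ?L edges_A"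
    by (simp_all add: table_tr_def edges_A_def edges_B_def)
  then have "?L edges_A \<noteq> ?L edges_B" by metis
  then have "ecard {?L edges_A, ?L edges_B} = 2" by (simp add: ecard_def numeral_eq_enat)
  then have "2 \<le> num_admissible (free_group {..<r}) 1 x"
    using ecard_mono[OF sub] by (simp add: num_admissible_def)
  also have "\<dots> \<le> sup_admissible (free_group {..<r}) 1"
    unfolding sup_admissible_def x_def using commutator_closed[OF c(1,2)] by (rule SUP_upper)
  finally show ?thesis .
qed

text \<open>This turns the hypothesis that the group is nonabelian into rank at least two. Any two
  letters over one generator are equal or inverse, hence commute, and two inductions extend this to
  words.\<close>

lemma comm_group_free_group:
  assumes "X \<subseteq> {x}"
  shows "comm_group (free_group X)"
proof -
  interpret group "free_group X" by (rule group_free_group)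
  let ?m = "\<lambda>u v. u \<otimes>\<^bsub>free_group X\<^esub> v"
  have split: "l # w = ?m [l] w" "[l] \<in> carrier (free_group X)" "w \<in> carrier (free_group X)"
    if "l # w \<in> carrier (free_group X)" for l w
    using that reduced_ConsD[of l w]
    by (simp_all add: mem_free_group mult_free_group cancel_cons_reduced reduced_def[of "[l]"])
  have commute_Cons: "?m v (l # w) = ?m (l # w) v"
    if "l # w \<in> carrier (free_group X)" "v \<in> carrier (free_group X)"
      "?m v [l] = ?m [l] v" "?m v w = ?m w v" for v l w
  proof -
    have "?m v (?m [l] w) = ?m (?m v [l]) w"
      using split(2,3)[OF that(1)] that(2) by (simp add: m_assoc)
    also have "\<dots> = ?m (?m [l] w) v"
      using split(2,3)[OF that(1)] that(2) by (simp add: that(3,4) m_assoc)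
    finally show ?thesis by (simp only: split(1)[OF that(1), symmetric])
  qed
  have letter: "w \<in> carrier (free_group X) \<Longrightarrow> ?m [l] w = ?m w [l]"
    if l: "[l] \<in> carrier (free_group X)" for l w
  proof (induction w)
    case Nil
    then show ?case using l_one[OF l] r_one[OF l] by (simp only: one_free_group)
  next
    case (Cons l' w)
    have "fst l' = fst l" using Cons.prems l assms by (auto simp: mem_free_group)
    then have "?m [l] [l'] = ?m [l'] [l]"
      by (auto simp: mult_free_group cancel_cons_def inv_letter_def prod_eq_iff)
    then show ?case using commute_Cons[OF Cons.prems l] Cons.IH[OF split(3)[OF Cons.prems]] by blast
  qed
  have "v \<in> carrier (free_group X) \<Longrightarrow> ?m u v = ?m v u" if u: "u \<in> carrier (free_group X)" for u v
  proof (induction v)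
    case Nil
    then show ?case using l_one[OF u] r_one[OF u] by (simp only: one_free_group)
  next
    case (Cons l v)
    show ?case
      using commute_Cons[OF Cons.prems u] letter[OF split(2)[OF Cons.prems] u]
        Cons.IH[OF split(3)[OF Cons.prems]] by simp
  qed
  then show ?thesis by (intro group.group_comm_groupI group_free_group)
qed

theorem theorem1p9:
  fixes F :: "('a, 'b) monoid_scheme"
  assumes "group F" and "free_of_finite_rank F" and "\<not> comm_group F"
  shows "sup_admissible F 1 \<ge> 2 \<and>
    (\<forall>m n::nat. m \<ge> 1 \<longrightarrow> n \<ge> 1 \<longrightarrow> sup_admissible F (m + n)
      \<ge> sup_admissible F m * sup_admissible F n)"
proof -
  obtain r :: nat where iso: "F \<cong> free_group {..<r}"
    using assms(2) by (auto simp: free_of_finite_rank_def)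
  then have iso': "free_group {..<r} \<cong> F" by (rule group.iso_sym[OF assms(1)])
  have "r \<ge> 2"
  proof (rule ccontr)
    assume "\<not> r \<ge> 2"
    then have "{..<r} \<subseteq> {0}" by auto
    then have "comm_group (free_group {..<r})" by (rule comm_group_free_group)
    then have "comm_group F"
      using iso' comm_group.iso_imp_comm_group group.is_monoid[OF assms(1)] by blast
    with assms(3) show False by simp
  qed
  moreover have "sup_admissible F g = sup_admissible (free_group {..<r}) g" for g
    using sup_admissible_is_iso[OF assms(1) group_free_group iso]
      sup_admissible_is_iso[OF group_free_group assms(1) iso'] by (rule antisym)
  ultimately show ?thesis
    using two_le_sup_admissible[of r] sup_admissible_mult[of r] by simp
qed

end
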